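(* Let $d\ge5$, $0<\gamma<d-2$, $0<\delta<1$, put $p_N=N^{-\gamma}$, and let $\Omega_N\subseteq Q_N$ be the binomial random subset obtained by retaining each point of $Q_N$ independently with probability $p_N$. Let $s>r\ge2$ and $J\ge0$ be integers for which there exist constants $c_0,c_1,c_2,\mathfrak c>0$ such that property (P) of the context holds, and let $\mathcal Q=\{r^js^{J-j}:0\le j\le J\}$. Let $(\lambda_N)_{N\in\mathbb N}$ be any sequence of positive integers satisfying $\lambda_N=o\big(p_N^{-2/(d-2)}\big)$ as $N\to\infty$. Then there exists a deterministic sequence $\varepsilon_N\to0$ such that, with probability tending to $1$ as $N\to\infty$, there is a set $B_N\subseteq\Omega_N$ satisfying $|B_N|\ge(1-\varepsilon_N)|\Omega_N|$ and $$D^2(B_N)\cap\{q^2\lambda_N:q\in\mathcal Q\}=\varnothing.$$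
   Context: $Q_N=[-N,N]^d\cap\mathbb Z^d$; $S_\lambda=\{\mathbf v\in\mathbb Z^d:|\mathbf v|^2=\lambda\}$; $A_\lambda^{(q)}f(\mathbf x)=\frac1{|S_\lambda|}\sum_{\mathbf v\in S_\lambda}f(\mathbf x+q\mathbf v)$; $D^2(B)=\{|\mathbf x-\mathbf y|^2:\mathbf x,\mathbf y\in B\}$. Property (P) for $(d,\delta,\gamma;r,s,J,c_0,c_1,c_2,\mathfrak c)$: for all sufficiently large $N$, with probability at least $1-\exp(-\mathfrak cN^{d-\gamma})$, every $B\subseteq\Omega_N$ with $|B|\ge\delta|\Omega_N|$ satisfies $$\frac1{|Q_N|}\sum_{\mathbf x\in\mathbb Z^d}\mathbf 1_B(\mathbf x)\sum_{j=0}^JA^{(r^j)}_{s^{2(J-j)}\lambda}\mathbf 1_B(\mathbf x)\ge c_0p_N^2$$ for every integer $\lambda$ with $c_1p_N^{-2/(d-2)}\le\lambda\le c_2N^2$. (For all $d\ge5$, $0<\gamma<d-2$, $0<\delta<1$, such parameters exist.) *)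

theory Defs
  imports "HOL-Probability.Probability" "HOL-Library.Landau_Symbols"
begin

(* The lattice Z^d is the type int ^ 'd, with d = CARD('d). *)

definition norm_sq :: "int ^ 'd::finite \<Rightarrow> int"
  where "norm_sq v = (\<Sum>i\<in>UNIV. (v $ i)\<^sup>2)"

definition lattice_box :: "nat \<Rightarrow> (int ^ 'd::finite) set"
  where "lattice_box N = {x. \<forall>i. \<bar>x $ i\<bar> \<le> int N}"

definition lattice_sphere :: "int \<Rightarrow> (int ^ 'd::finite) set"
  where "lattice_sphere l = {v. norm_sq v = l}"

definition sphere_avg ::
    "nat \<Rightarrow> int \<Rightarrow> (int ^ 'd::finite \<Rightarrow> real) \<Rightarrow> int ^ 'd \<Rightarrow> real"
  where "sphere_avg q l f x =
    (1 / real (card (lattice_sphere l :: (int ^ 'd) set))) *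
    (\<Sum>v\<in>lattice_sphere l. f (x + int q *s v))"

definition sq_dists :: "(int ^ 'd::finite) set \<Rightarrow> int set"
  where "sq_dists B = {norm_sq (x - y) | x y. x \<in> B \<and> y \<in> B}"

definition binomial_subset :: "'a set \<Rightarrow> real \<Rightarrow> 'a set pmf"
  where "binomial_subset A p =
    map_pmf (\<lambda>f. {x\<in>A. f x}) (Pi_pmf A False (\<lambda>_. bernoulli_pmf p))"

(* Only N \<ge> 1 matters: 0 powr a = 0, so the value at N = 0 is a dummy. *)
definition retention_prob :: "real \<Rightarrow> nat \<Rightarrow> real"
  where "retention_prob \<gamma> N = real N powr (- \<gamma>)"

(* The law of the random set Omega_N. *)
definition random_box :: "real \<Rightarrow> nat \<Rightarrow> (int ^ 'd::finite) set pmf"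
  where "random_box \<gamma> N = binomial_subset (lattice_box N) (retention_prob \<gamma> N)"

(* The dimension enters through the type argument. The sum over the whole lattice is an
   infsum (the summand is supported on the finite set B); sum over UNIV would be 0. *)
definition property_P ::
    "'d::finite itself \<Rightarrow> real \<Rightarrow> real \<Rightarrow> nat \<Rightarrow> nat \<Rightarrow> nat \<Rightarrow>
     real \<Rightarrow> real \<Rightarrow> real \<Rightarrow> real \<Rightarrow> bool"
  where "property_P _ \<delta> \<gamma> r s J c0 c1 c2 c \<longleftrightarrow>
    (\<forall>\<^sub>F N in sequentially.
      measure_pmf.prob (random_box \<gamma> N :: (int ^ 'd) set pmf)
        {\<Omega>. \<forall>B\<subseteq>\<Omega>. real (card B) \<ge> \<delta> * real (card \<Omega>) \<longrightarrow>
          (\<forall>l::int.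
            c1 * retention_prob \<gamma> N powr (- 2 / (real CARD('d) - 2)) \<le> real_of_int l \<and>
            real_of_int l \<le> c2 * (real N)\<^sup>2 \<longrightarrow>
            (1 / real (card (lattice_box N :: (int ^ 'd) set))) *
              (\<Sum>\<^sub>\<infinity>x\<in>UNIV. indicator B x *
                (\<Sum>j=0..J. sphere_avg (r ^ j) (int s ^ (2 * (J - j)) * l) (indicator B) x))
              \<ge> c0 * (retention_prob \<gamma> N)\<^sup>2)}
      \<ge> 1 - exp (- c * real N powr (real CARD('d) - \<gamma>)))"

definition scales :: "nat \<Rightarrow> nat \<Rightarrow> nat \<Rightarrow> nat set"
  where "scales r s J = {r ^ j * s ^ (J - j) | j. j \<le> J}"

end

theory Submission
  imports Defs
begin

text \<open>Write $\lambda = \lambda_N$, $p = p_N$, and let $V$ be the set of lattice vectors whose squared length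
is $q^2\lambda$ for some scale $q$. A point of $\Omega_N$ is bad if translating it by some vector of $V$
leads to another point of $\Omega_N$. Deleting the bad points from $\Omega_N$ leaves a set without any of
the forbidden distances. There are at most $|Q_N| |V|$ forbidden pairs in $Q_N$, each of which
survives with probability $p^2$, so the expected number of bad points is at most $p |V|$ times
$p |Q_N|$, the expected size of $\Omega_N$. Thus the deletion is negligible as soon as $p |V| \to 0$: Markov's
inequality bounds the number of bad points, and Chebyshev's inequality bounds $|\Omega_N|$ from below
(\<open>prob_large_independent_subset\<close>).

The hypothesis on $\lambda$ says exactly that $p \lambda^{(d-2)/2} \to 0$, so what is needed is the bound
$|S_m| \le C m^{(d-2)/2}$ for the number of lattice points on a sphere, without any logarithmic loss
(\<open>card_lattice_sphere_le\<close>). It holds for $d \ge 5$ and is the substantial part of the proof.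
The circle method gives it: with $R \approx \sqrt m$ and
$G(\alpha) = \sum_{|x| \le R} e(\alpha x^2)$, the count is at most $\int_0^1 |G|^d \ll R^{d-5} \int_0^1 |G|^5$, and
the fifth moment is $O(R^3)$ (\<open>gauss_sum_fifth_moment\<close>).

For the fifth moment, Weyl differencing bounds $|G(\alpha)|^2$ by a sum over $|h| \le 2R$ of
$\min(R, 1/\|2\alpha h\|)$, where $\|x\|$ is the distance from $x$ to the nearest integer. Summing this directly
would cost logarithms. They are avoided by replacing the minimum by $R (R\|2\alpha h\|)^{-4/5}$. If
$2\alpha$ is close to the reduced fraction $a/q$, the result is
$$|G(\alpha)|^2 \ll \frac{R^2}{q} (1 + R^2 |2\alpha - a/q|)^{-4/5} + R^{6/5}.$$
The exponent $4/5$ is the one that fits the fifth moment: raised to the power $5/2$, the second term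
becomes $R^3$ and the first one becomes an integrable function of $2\alpha - a/q$ with integral of order
$R^3 q^{-5/2}$. There are $O(q)$ numerators $a$ for each $q$, and $\sum_q q^{-3/2}$ converges.\<close>

section \<open>Distance to the nearest integer and geometric sums\<close>

definition int_dist :: "real \<Rightarrow> real"
  where "int_dist x = \<bar>x - of_int (round x)\<bar>"

lemma int_dist_le: "int_dist x \<le> \<bar>x - of_int m\<bar>"
  unfolding int_dist_def by (rule round_diff_minimal)

lemma int_dist_le_half: "int_dist x \<le> 1 / 2"
  unfolding int_dist_def using of_int_round_abs_le[of x] by (simp add: abs_minus_commute)

lemma int_dist_minus [simp]: "int_dist (- x) = int_dist x"
proof -
  have "int_dist (- y) \<le> int_dist y" for y
    using int_dist_le[of "- y" "- round y"] unfolding int_dist_def[of y] by simp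
  from this[of x] this[of "- x"] show ?thesis by simp
qed

lemma int_dist_add_int [simp]: "int_dist (x + of_int m) = int_dist x"
proof -
  have "int_dist (y + of_int k) \<le> int_dist y" for y k
    using int_dist_le[of "y + of_int k" "round y + k"] unfolding int_dist_def[of y] by simp
  from this[of x m] this[of "x + of_int m" "- m"] show ?thesis by simp
qed

text \<open>The distance to the integers is 1-Lipschitz; this transfers lower bounds from the multiples of a
fraction to the multiples of a nearby real number.\<close>

lemma int_dist_diff_le: "int_dist x - \<bar>y - x\<bar> \<le> int_dist y"
  using int_dist_le[of x "round y"] unfolding int_dist_def[of y] by linarith

lemma int_dist_eq_abs: "\<bar>x\<bar> \<le> 1 / 2 \<Longrightarrow> int_dist x = \<bar>x\<bar>"
proof (rule antisym)
  assume "\<bar>x\<bar> \<le> 1 / 2"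
  show "int_dist x \<le> \<bar>x\<bar>" using int_dist_le[of x 0] by simp
  have "\<bar>x\<bar> \<le> \<bar>x - of_int m\<bar>" for m
  proof (cases "m = 0")
    case False
    then have "\<bar>real_of_int m\<bar> \<ge> 1" by linarith
    with \<open>\<bar>x\<bar> \<le> 1 / 2\<close> show ?thesis by linarith
  qed simp
  then show "\<bar>x\<bar> \<le> int_dist x" unfolding int_dist_def .
qed

text \<open>Jordan's inequality: by concavity the sine lies above its chord on $[0, \pi/2]$.\<close>

lemma sin_ge_linear:
  assumes "0 \<le> t" "t \<le> pi / 2"
  shows "2 * t / pi \<le> sin t"
proof -
  have "convex_on {0..pi/2} (\<lambda>x. - sin x)"
    by (rule f''_ge0_imp_convex[where f' = "\<lambda>x. - cos x" and f'' = sin])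
       (auto intro!: derivative_eq_intros sin_ge_zero)
  then have "- sin ((1 - 2 * t / pi) *\<^sub>R 0 + (2 * t / pi) *\<^sub>R (pi / 2))
      \<le> (1 - 2 * t / pi) * (- sin 0) + (2 * t / pi) * (- sin (pi / 2))"
    using assms by (intro convex_onD) (auto simp: field_simps)
  then show ?thesis by simp
qed

lemma abs_sin_pi_ge_int_dist: "2 * int_dist \<theta> \<le> \<bar>sin (pi * \<theta>)\<bar>"
proof -
  define r where "r = \<theta> - of_int (round \<theta>)"
  have r: "int_dist \<theta> = \<bar>r\<bar>" "\<bar>r\<bar> \<le> 1 / 2"
    using int_dist_le_half[of \<theta>] by (auto simp: r_def int_dist_def)
  have "\<theta> = r + of_int (round \<theta>)" by (simp add: r_def)
  then have "pi * \<theta> = pi * r + of_int (round \<theta>) * pi" by (metis distrib_left mult.commute)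
  moreover have s0: "sin (of_int (round \<theta>) * pi) = 0"
    by (auto simp: sin_zero_iff_int2)
  moreover have "\<bar>cos (of_int (round \<theta>) * pi)\<bar> = 1"
    using sin_cos_squared_add[of "of_int (round \<theta>) * pi"] s0
    by (simp add: power2_eq_1_iff) (auto)
  ultimately have "\<bar>sin (pi * \<theta>)\<bar> = \<bar>sin (pi * r)\<bar>"
    by (simp add: sin_add abs_mult)
  also have "\<dots> = sin (pi * \<bar>r\<bar>)"
  proof -
    have "sin (pi * \<bar>r\<bar>) \<ge> 0" using r by (intro sin_ge_zero) (auto simp: mult_le_cancel_left1)
    then show ?thesis by (cases "r \<ge> 0") auto
  qed
  also have "\<dots> \<ge> 2 * \<bar>r\<bar>"
    using sin_ge_linear[of "pi * \<bar>r\<bar>"] r by simp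
  finally show ?thesis using r by simp
qed

lemma norm_cis_minus_one: "cmod (cis t - 1) = 2 * \<bar>sin (t / 2)\<bar>"
proof -
  have "(cmod (cis t - 1))\<^sup>2 = (cos t - 1)\<^sup>2 + (sin t)\<^sup>2"
    by (simp add: cmod_power2)
  also have "\<dots> = 2 - 2 * cos t"
    using sin_cos_squared_add[of t] by (simp add: power2_eq_square algebra_simps)
  also have "\<dots> = (2 * \<bar>sin (t / 2)\<bar>)\<^sup>2"
    using cos_double_sin[of "t / 2"] by (simp add: power_mult_distrib)
  finally show ?thesis by (rule power2_eq_imp_eq) auto
qed

text \<open>The sum telescopes after multiplication by $e(\theta) - 1$, whose modulus is
$2 |\sin \pi\theta| \ge 4 \|\theta\|$. The product form of the bound stays meaningful when $\theta$ is an integer.\<close>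

lemma geometric_cis_sum_le:
  "cmod (\<Sum>y\<in>{a..b::int}. cis (2 * pi * \<theta> * of_int y)) * (2 * int_dist \<theta>) \<le> 1"
proof (cases "a \<le> b")
  case True
  define E where "E y = cis (2 * pi * \<theta> * of_int y)" for y :: int
  have E_step: "E (y + 1) = E y * cis (2 * pi * \<theta>)" for y
    by (simp add: E_def cis_mult algebra_simps)
  have "(\<Sum>y\<in>{a..b}. E y) * (cis (2 * pi * \<theta>) - 1) = E (b + 1) - E a"
    using True
  proof (induction b rule: int_ge_induct)
    case base
    show ?case using E_step[of a] by (simp add: algebra_simps)
  next
    case (step i)
    have "{a..i + 1} = insert (i + 1) {a..i}" using step.hyps by auto
    then show ?case using step E_step[of "i + 1"] by (simp add: algebra_simps)
  qed
  then have "cmod (\<Sum>y\<in>{a..b}. E y) * cmod (cis (2 * pi * \<theta>) - 1) = cmod (E (b + 1) - E a)"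
    by (metis norm_mult)
  also have "\<dots> \<le> 2"
    using norm_triangle_ineq4[of "E (b + 1)" "E a"] by (simp add: E_def)
  finally have "cmod (\<Sum>y\<in>{a..b}. E y) * (2 * \<bar>sin (pi * \<theta>)\<bar>) \<le> 2"
    by (simp add: norm_cis_minus_one)
  moreover have "cmod (\<Sum>y\<in>{a..b}. E y) * (2 * int_dist \<theta>)
      \<le> cmod (\<Sum>y\<in>{a..b}. E y) * \<bar>sin (pi * \<theta>)\<bar>"
    by (intro mult_left_mono abs_sin_pi_ge_int_dist) auto
  ultimately show ?thesis by (simp add: E_def)
qed simp

section \<open>Weyl differencing\<close>

definition gauss_sum :: "nat \<Rightarrow> real \<Rightarrow> complex"
  where "gauss_sum R \<alpha> = (\<Sum>x\<in>{- int R..int R}. cis (2 * pi * \<alpha> * of_int (x\<^sup>2)))"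

text \<open>In the expansion of $|G|^2$ over pairs $(x, y)$, the substitution $x = y + h$ turns the phase
$x^2 - y^2$ into $2hy + h^2$, which is linear in $y$. The inner sums are then geometric sums over
intervals.\<close>

lemma weyl_differencing:
  fixes R :: nat and \<alpha> :: real
  defines "I \<equiv> \<lambda>h. {max (- int R) (- int R - h)..min (int R) (int R - h)}"
  shows "(cmod (gauss_sum R \<alpha>))\<^sup>2 \<le>
    (\<Sum>h\<in>{- 2 * int R..2 * int R}. cmod (\<Sum>y\<in>I h. cis (2 * pi * (2 * \<alpha> * of_int h) * of_int y)))"
proof -
  let ?B = "{- int R..int R}"
  let ?H = "{- 2 * int R..2 * int R}"
  define E where "E z = cis (2 * pi * \<alpha> * of_int z)" for z :: int
  have E_add: "E (z + w) = E z * E w" for z w by (simp add: E_def cis_mult algebra_simps)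
  have "complex_of_real ((cmod (gauss_sum R \<alpha>))\<^sup>2) = gauss_sum R \<alpha> * cnj (gauss_sum R \<alpha>)"
    by (rule complex_norm_square)
  also have "\<dots> = (\<Sum>(x, y)\<in>?B \<times> ?B. E (x\<^sup>2 - y\<^sup>2))"
    by (simp add: gauss_sum_def E_def sum_product sum.cartesian_product cis_cnj cis_mult algebra_simps)
  also have "\<dots> = (\<Sum>(h, y)\<in>Sigma ?H I. E ((y + h)\<^sup>2 - y\<^sup>2))"
    by (rule sum.reindex_bij_witness[where i = "\<lambda>(h, y). (y + h, y)" and j = "\<lambda>(x, y). (x - y, y)"])
       (auto simp: I_def)
  also have "\<dots> = (\<Sum>h\<in>?H. \<Sum>y\<in>I h. E ((y + h)\<^sup>2 - y\<^sup>2))"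
    by (rule sum.Sigma[symmetric]) (auto simp: I_def)
  also have "\<dots> = (\<Sum>h\<in>?H. E (h\<^sup>2) * (\<Sum>y\<in>I h. cis (2 * pi * (2 * \<alpha> * of_int h) * of_int y)))"
  proof (rule sum.cong[OF refl])
    fix h
    have "E ((y + h)\<^sup>2 - y\<^sup>2) = E (h\<^sup>2) * cis (2 * pi * (2 * \<alpha> * of_int h) * of_int y)" for y
    proof -
      have "E ((y + h)\<^sup>2 - y\<^sup>2) = E (h\<^sup>2 + 2 * h * y)" by (simp add: power2_eq_square algebra_simps)
      also have "\<dots> = E (h\<^sup>2) * E (2 * h * y)" by (rule E_add)
      also have "E (2 * h * y) = cis (2 * pi * (2 * \<alpha> * of_int h) * of_int y)"
        by (simp add: E_def mult_ac)
      finally show ?thesis .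
    qed
    then show "(\<Sum>y\<in>I h. E ((y + h)\<^sup>2 - y\<^sup>2)) =
        E (h\<^sup>2) * (\<Sum>y\<in>I h. cis (2 * pi * (2 * \<alpha> * of_int h) * of_int y))"
      by (simp add: sum_distrib_left)
  qed
  finally have "(cmod (gauss_sum R \<alpha>))\<^sup>2 =
      cmod (\<Sum>h\<in>?H. E (h\<^sup>2) * (\<Sum>y\<in>I h. cis (2 * pi * (2 * \<alpha> * of_int h) * of_int y)))"
    by (metis norm_of_real abs_power2)
  also have "\<dots> \<le> (\<Sum>h\<in>?H. cmod (E (h\<^sup>2) * (\<Sum>y\<in>I h. cis (2 * pi * (2 * \<alpha> * of_int h) * of_int y))))"
    by (rule norm_sum)
  finally show ?thesis by (simp add: norm_mult E_def)
qed

section \<open>Sums of reciprocal distances along a nearly rational rotation\<close>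

text \<open>Since the exponent is below 1, the sum has the order of $n$ times its last term, with no logarithm.
The induction step is the factorisation of $b^5 - a^5$ for $a = n^{1/5}$ and $b = (n+1)^{1/5}$.\<close>

lemma sum_powr_le:
  "(\<Sum>j=1..n. real j powr (- 4 / 5)) \<le> 5 * real n powr (1 / 5)"
proof (induction n)
  case (Suc n)
  define a where "a = real n powr (1 / 5)"
  define b where "b = real (Suc n) powr (1 / 5)"
  have ab: "0 \<le> a" "a \<le> b" "0 < b" by (auto simp: a_def b_def powr_mono2)
  have a5: "a ^ 5 = real n" by (cases "n = 0") (simp_all add: a_def powr_power)
  have b5: "b ^ 5 = real (Suc n)" by (simp add: b_def powr_power)
  have b4: "real (Suc n) powr (- 4 / 5) = 1 / b ^ 4"
    by (simp add: b_def powr_power powr_minus field_simps)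
  have "1 = (b - a) * (b ^ 4 + b ^ 3 * a + b ^ 2 * a ^ 2 + b * a ^ 3 + a ^ 4)"
  proof -
    have "1 = b ^ 5 - a ^ 5" by (simp add: a5 b5)
    then show ?thesis by (simp add: algebra_simps eval_nat_numeral)
  qed
  also have "\<dots> \<le> (b - a) * (b ^ 4 + b ^ 3 * b + b ^ 2 * b ^ 2 + b * b ^ 3 + b ^ 4)"
    using ab by (intro mult_left_mono add_mono power_mono) auto
  also have "\<dots> = (b - a) * (5 * b ^ 4)" by (simp add: eval_nat_numeral)
  finally have "1 / b ^ 4 \<le> 5 * (b - a)"
    using ab by (simp add: divide_simps) (simp add: algebra_simps)
  with Suc b4 show ?case by (simp add: a_def b_def)
qed simp

text \<open>A bound $w \le \min(M, M/y)$, up to constants, is weakened to $M z^{-4/5}$. This is the step that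
sacrifices decay in $y$ to make the later sums free of logarithms. The value of $z$ may be
smaller than $1 + y$, so that it can be chosen as a product.\<close>

lemma le_mult_powr_of_damping:
  fixes w y z M :: real
  assumes "w * (1 + y) \<le> M" "0 \<le> y" "0 < z" "z \<le> 1 + y" "0 \<le> M"
  shows "w \<le> M * z powr (- 4 / 5)"
proof -
  have "w \<le> M * (1 + y) powr (- 1)"
    using assms by (simp add: powr_minus field_simps)
  also have "\<dots> \<le> M * (1 + y) powr (- 4 / 5)"
    using assms by (intro mult_left_mono powr_mono) auto
  also have "\<dots> \<le> M * z powr (- 4 / 5)"
    using assms by (intro mult_left_mono powr_mono2') auto
  finally show ?thesis .
qed

lemma int_dist_fraction_powr_le:
  assumes "1 \<le> j" "j < q"
  shows "int_dist (real j / real q) powr (- 4 / 5)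
    \<le> (real j / real q) powr (- 4 / 5) + (real (q - j) / real q) powr (- 4 / 5)"
proof -
  define x where "x = real j / real q"
  have x: "0 < x" "x < 1" using assms by (auto simp: x_def)
  have y: "real (q - j) / real q = 1 - x"
    using assms by (simp add: x_def of_nat_diff field_simps)
  have "int_dist x = x \<or> int_dist x \<ge> 1 - x"
  proof (cases "round x \<le> 0")
    case True
    then have "real_of_int (round x) \<le> 0" by simp
    then have "x \<le> int_dist x" using x by (simp add: int_dist_def)
    moreover have "int_dist x \<le> x" using int_dist_le[of x 0] x by simp
    ultimately show ?thesis by simp
  next
    case False
    then have "real_of_int (round x) \<ge> 1" by simp
    then show ?thesis using x by (simp add: int_dist_def)
  qed
  then show ?thesis
  proof
    assume "int_dist x = x"
    then show ?thesis by (simp add: x_def)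
  next
    assume "int_dist x \<ge> 1 - x"
    then have "int_dist x powr (- 4 / 5) \<le> (1 - x) powr (- 4 / 5)"
      using x by (intro powr_mono2') auto
    then show ?thesis unfolding y unfolding x_def[symmetric]
      by (smt (verit) powr_ge_zero)
  qed
qed

text \<open>With $\|j/q\| = \min(j, q - j)/q$, the sum is at most two copies of $\sum_j (q/j)^{4/5}$. The term $j = 0$
contributes nothing because \<open>0 powr a = 0\<close>.\<close>

lemma sum_int_dist_residues_le:
  assumes "q > 0"
  shows "(\<Sum>j<q. int_dist (real j / real q) powr (- 4 / 5)) \<le> 10 * real q"
proof -
  have pw: "(real j / real q) powr (- 4 / 5) = real q powr (4 / 5) * real j powr (- 4 / 5)" for j
    by (simp add: powr_divide powr_minus_divide)
  have s: "(\<Sum>j=1..q-1. (real j / real q) powr (- 4 / 5)) \<le> 5 * real q"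
  proof -
    have "(\<Sum>j=1..q-1. (real j / real q) powr (- 4 / 5)) =
        real q powr (4 / 5) * (\<Sum>j=1..q-1. real j powr (- 4 / 5))"
      by (simp only: pw sum_distrib_left)
    also have "\<dots> \<le> real q powr (4 / 5) * (5 * real (q - 1) powr (1 / 5))"
      by (intro mult_left_mono sum_powr_le) auto
    also have "\<dots> \<le> real q powr (4 / 5) * (5 * real q powr (1 / 5))"
      by (intro mult_left_mono powr_mono2) auto
    also have "\<dots> = 5 * real q powr (4 / 5 + 1 / 5)"
      by (simp only: powr_add mult_ac)
    finally show ?thesis by simp
  qed
  have "(\<Sum>j<q. int_dist (real j / real q) powr (- 4 / 5)) =
      (\<Sum>j=1..q-1. int_dist (real j / real q) powr (- 4 / 5))"
  proof -
    have "{..<q} = insert 0 {1..q-1}" using assms by auto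
    then show ?thesis by (simp add: int_dist_def)
  qed
  also have "\<dots> \<le> (\<Sum>j=1..q-1. (real j / real q) powr (- 4 / 5) + (real (q - j) / real q) powr (- 4 / 5))"
    by (intro sum_mono int_dist_fraction_powr_le) auto
  also have "\<dots> = 2 * (\<Sum>j=1..q-1. (real j / real q) powr (- 4 / 5))"
  proof -
    have "(\<Sum>j=1..q-1. (real (q - j) / real q) powr (- 4 / 5)) =
        (\<Sum>j=1..q-1. (real j / real q) powr (- 4 / 5))"
      by (rule sum.reindex_bij_witness[where i = "\<lambda>j. q - j" and j = "\<lambda>j. q - j"]) auto
    then show ?thesis by (simp add: sum.distrib)
  qed
  finally show ?thesis using s by simp
qed

text \<open>Multiplication by a unit $a$ permutes the residues modulo $q$, so every block of $q$ consecutive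
values of $h$ contributes the complete residue sum. The multiples of $q$ are included in the
range but contribute 0, again because \<open>0 powr a = 0\<close>.\<close>

lemma sum_int_dist_multiples_le:
  fixes a :: int and q T :: nat
  assumes "coprime a (int q)" "q > 0"
  shows "(\<Sum>h<T * q. int_dist (of_int a * real h / real q) powr (- 4 / 5)) \<le> 10 * real q * real T"
proof -
  define G where "G z = int_dist (of_int z / real q) powr (- 4 / 5)" for z :: int
  have per: "G (z + k * int q) = G z" for z k
  proof -
    have "of_int (z + k * int q) / real q = of_int z / real q + of_int k"
      using assms by (simp add: field_simps)
    then show ?thesis by (simp add: G_def)
  qed
  have Gmod: "G (z mod int q) = G z" for z
    using per[of "z mod int q" "z div int q"] by (simp add: add.commute)
  define \<pi> where "\<pi> h = nat ((a * int h) mod int q)" for h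
  have "inj_on \<pi> {..<q}"
  proof (rule inj_onI)
    fix h h' assume h: "h \<in> {..<q}" "h' \<in> {..<q}" "\<pi> h = \<pi> h'"
    then have "(a * int h) mod int q = (a * int h') mod int q"
      using assms by (simp add: \<pi>_def nat_eq_iff)
    then have "int q dvd a * (int h - int h')"
      by (simp add: mod_eq_dvd_iff algebra_simps)
    then have "int q dvd int h - int h'"
      using assms coprime_dvd_mult_right_iff[of "int q" a] by (simp add: coprime_commute)
    moreover have "\<bar>int h - int h'\<bar> < int q" using h by auto
    ultimately show "h = h'" using dvd_imp_le_int[of "int h - int h'" "int q"] by force
  qed
  moreover have "\<pi> ` {..<q} \<subseteq> {..<q}" using assms by (auto simp: \<pi>_def nat_less_iff)
  ultimately have bij: "bij_betw \<pi> {..<q} {..<q}"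
    by (simp add: bij_betw_def endo_inj_surj)
  have block: "(\<Sum>h<q. G (a * int h)) \<le> 10 * real q"
  proof -
    have "(\<Sum>h<q. G (a * int h)) = (\<Sum>h<q. G (int (\<pi> h)))"
      using assms by (simp add: \<pi>_def Gmod)
    also have "\<dots> = (\<Sum>j<q. G (int j))"
      by (rule sum.reindex_bij_betw[OF bij])
    also have "\<dots> \<le> 10 * real q"
      using sum_int_dist_residues_le[OF \<open>q > 0\<close>] by (simp add: G_def)
    finally show ?thesis .
  qed
  have "(\<Sum>h<T * q. int_dist (of_int a * real h / real q) powr (- 4 / 5)) = (\<Sum>h<T * q. G (a * int h))"
    by (simp add: G_def)
  also have "\<dots> = (\<Sum>m<T. \<Sum>h\<in>{m * q..<m * q + q}. G (a * int h))"
    by (rule sum.nat_group[symmetric])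
  also have "\<dots> = (\<Sum>m<T. \<Sum>h<q. G (a * int h))"
  proof (rule sum.cong[OF refl])
    fix m
    have "(\<Sum>h\<in>{m * q..<m * q + q}. G (a * int h)) = (\<Sum>h<q. G (a * int (h + m * q)))"
      using sum.shift_bounds_nat_ivl[of "\<lambda>h. G (a * int h)" 0 "m * q" q]
      by (simp add: atLeast0LessThan add.commute)
    also have "\<dots> = (\<Sum>h<q. G (a * int h))"
      using per[of "a * int _" "a * int m"] by (simp add: algebra_simps)
    finally show "(\<Sum>h\<in>{m * q..<m * q + q}. G (a * int h)) = (\<Sum>h<q. G (a * int h))" .
  qed
  also have "\<dots> \<le> (\<Sum>m<T. 10 * real q)" by (intro sum_mono block)
  finally show ?thesis by (simp add: mult_ac)
qed

text \<open>Here $W(h)$ stands for any quantity bounded by $\min(3R, 1/(2\|\omega h\|))$. Put $\beta = \omega - a/q$. The approximation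
is so good that $h |\beta| \le 1/(2q)$ throughout the range $h \le 2R$, which separates two kinds of $h$.

If $q$ divides $h$, then $ah/q$ is an integer and $\|\omega h\| = h |\beta|$. There are about $2R/q$ such $h$, and they
yield the main term. If $q$ does not divide $h$, then $\|ah/q\| \ge 1/q$, hence the perturbation is
at most half of it and $\|\omega h\|$ may be replaced by $\|ah/q\|/2$. These $h$ fill $O(R/q + 1)$ complete
residue systems, and $q \le 4R$ makes their total contribution $O(R^{6/5})$.\<close>

lemma reciprocal_distance_sum_le:
  fixes W :: "nat \<Rightarrow> real" and R q :: nat and a :: int and \<omega> :: real
  assumes "R > 0" "q > 0" "q \<le> 4 * R" "coprime a (int q)"
    and approx: "\<bar>real q * \<omega> - of_int a\<bar> \<le> 1 / (4 * real R)"
    and W0: "\<And>h. 0 \<le> W h"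
    and W1: "\<And>h. W h \<le> 3 * real R"
    and W2: "\<And>h. W h * (2 * int_dist (\<omega> * real h)) \<le> 1"
  shows "(\<Sum>h=1..2*R. W h) \<le> 60 * ((real R)\<^sup>2 / real q) *
      (1 + (real R)\<^sup>2 * \<bar>\<omega> - of_int a / real q\<bar>) powr (- 4 / 5) + 360 * real R powr (6 / 5)"
proof -
  define \<beta> where "\<beta> = \<omega> - of_int a / real q"
  define K where "K = (real R)\<^sup>2 * \<bar>\<beta>\<bar>"
  have K0: "K \<ge> 0" by (simp add: K_def)
  have "real q * \<bar>\<beta>\<bar> = \<bar>real q * \<omega> - of_int a\<bar>"
  proof -
    have "real q * \<beta> = real q * \<omega> - of_int a"
      using assms by (simp add: \<beta>_def field_simps)
    then show ?thesis by (metis abs_mult abs_of_nat)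
  qed
  then have "real q * \<bar>\<beta>\<bar> \<le> 1 / (4 * real R)" using approx by simp
  then have \<beta>: "\<bar>\<beta>\<bar> \<le> 1 / (4 * real R * real q)"
    using \<open>R > 0\<close> \<open>q > 0\<close> by (simp add: field_simps)
  have h\<beta>: "real h * \<bar>\<beta>\<bar> \<le> 1 / (2 * real q)" if "h \<le> 2 * R" for h
  proof -
    have "real h * \<bar>\<beta>\<bar> \<le> (2 * real R) * (1 / (4 * real R * real q))"
      using that \<beta> by (intro mult_mono) auto
    also have "\<dots> = 1 / (2 * real q)" using assms by (simp add: field_simps)
    finally show ?thesis .
  qed
  have split: "\<omega> * real h = of_int a * real h / real q + real h * \<beta>" for h
    by (simp add: \<beta>_def algebra_simps)

  \<comment> \<open>Both rates, the decay in $h$ and the decay in $K$, come from the single factor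
    $(h/2R)(1 + K) \le 1 + (h/2R) K$, which holds since $h \le 2R$.\<close>
  have major: "W h \<le> 6 * real R * ((real h / (2 * real R)) * (1 + K)) powr (- 4 / 5)"
    if h: "h \<ge> 1" "h \<le> 2 * R" "q dvd h" for h
  proof (rule le_mult_powr_of_damping[where y = "6 * real R * (real h * \<bar>\<beta>\<bar>)"])
    obtain t where t: "h = q * t" using h by blast
    have "1 / (2 * real q) \<le> 1 / 2" using assms by simp
    then have "\<bar>real h * \<beta>\<bar> \<le> 1 / 2" using h\<beta>[OF h(2)] by (simp add: abs_mult)
    moreover have "\<omega> * real h = real h * \<beta> + of_int (a * int t)"
      unfolding split using assms by (simp add: t)
    ultimately have "int_dist (\<omega> * real h) = real h * \<bar>\<beta>\<bar>"
      by (simp only: int_dist_add_int int_dist_eq_abs) (simp add: abs_mult)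
    then have "W h * (2 * (real h * \<bar>\<beta>\<bar>)) \<le> 1" using W2[of h] by simp
    then have "W h * (2 * (real h * \<bar>\<beta>\<bar>)) * (3 * real R) \<le> 1 * (3 * real R)"
      by (intro mult_right_mono) auto
    then show "W h * (1 + 6 * real R * (real h * \<bar>\<beta>\<bar>)) \<le> 6 * real R"
      using W1[of h] by (simp add: algebra_simps)
    have "real h / (2 * real R) \<le> 1" using h assms by simp
    moreover have "real h / (2 * real R) * K \<le> 6 * real R * (real h * \<bar>\<beta>\<bar>)"
      using assms by (simp add: K_def power2_eq_square field_simps)
    ultimately show "real h / (2 * real R) * (1 + K) \<le> 1 + 6 * real R * (real h * \<bar>\<beta>\<bar>)"
      by (simp add: distrib_left)
    show "0 < real h / (2 * real R) * (1 + K)" using h assms K0 by (auto intro!: mult_pos_pos)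
  qed auto

  have minor: "W h \<le> 6 * real R * (real R * int_dist (of_int a * real h / real q)) powr (- 4 / 5)"
    if h: "h \<le> 2 * R" "\<not> q dvd h" for h
  proof (rule le_mult_powr_of_damping[where y = "3 * real R * int_dist (of_int a * real h / real q)"])
    define x where "x = int_dist (of_int a * real h / real q)"
    have "\<not> int q dvd a * int h"
      using h assms coprime_dvd_mult_right_iff[of "int q" a] by (simp add: coprime_commute)
    then have ne: "a * int h - m * int q \<noteq> 0" for m by (metis dvd_triv_right eq_iff_diff_eq_0)
    have "x \<ge> 1 / real q"
    proof -
      define m where "m = round (of_int a * real h / real q)"
      have "1 \<le> \<bar>a * int h - m * int q\<bar>" using ne[of m] by linarith
      then have "real_of_int 1 \<le> real_of_int \<bar>a * int h - m * int q\<bar>"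
        by (simp only: of_int_le_iff)
      then have "1 \<le> \<bar>of_int a * real h - of_int m * real q\<bar>" by simp
      moreover have "of_int a * real h - of_int m * real q = real q * (of_int a * real h / real q - of_int m)"
        using assms by (simp add: field_simps)
      ultimately show ?thesis
        using assms by (simp add: x_def int_dist_def m_def abs_mult field_simps)
    qed
    moreover from this have x0: "0 < x" using assms by (simp add: less_le_trans[OF _ \<open>x \<ge> 1 / real q\<close>])
    moreover have "int_dist (\<omega> * real h) \<ge> x - real h * \<bar>\<beta>\<bar>"
      using int_dist_diff_le[of "of_int a * real h / real q" "\<omega> * real h"]
      by (simp add: x_def split abs_mult)
    moreover have "1 / (2 * real q) = (1 / real q) / 2" by simp
    ultimately have le: "x \<le> 2 * int_dist (\<omega> * real h)"
      using h\<beta>[OF h(1)] by linarith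
    have "W h * x \<le> 1"
      using mult_left_mono[OF le W0[of h]] W2[of h] by linarith
    then have "W h * x * (3 * real R) \<le> 1 * (3 * real R)"
      by (intro mult_right_mono) auto
    then show "W h * (1 + 3 * real R * x) \<le> 6 * real R"
      using W1[of h] by (simp add: algebra_simps)
    show "0 \<le> 3 * real R * x" "0 < real R * x" using x0 assms by auto
    then show "real R * x \<le> 1 + 3 * real R * x" by simp
  qed auto

  define M where "M = {h\<in>{1..2*R}. q dvd h}"
  define n where "n = 2 * R div q"
  have nq: "real n \<le> 2 * real R / real q"
  proof -
    have "n * q \<le> 2 * R" by (simp add: n_def)
    then have "real n * real q \<le> 2 * real R" by (metis of_nat_le_iff of_nat_mult of_nat_numeral)
    then show ?thesis using assms by (simp add: field_simps)
  qed
  have "sum W M \<le> (\<Sum>h\<in>M. 6 * real R * ((real h / (2 * real R)) * (1 + K)) powr (- 4 / 5))"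
    by (intro sum_mono major) (auto simp: M_def)
  also have "\<dots> = (\<Sum>t=1..n. 6 * real R * ((real (q * t) / (2 * real R)) * (1 + K)) powr (- 4 / 5))"
  proof -
    have iff: "q * t \<le> 2 * R \<longleftrightarrow> t \<le> n" for t
      using assms by (simp add: n_def less_eq_div_iff_mult_less_eq mult.commute)
    have "M = (\<lambda>t. q * t) ` {1..n}"
    proof (intro equalityI subsetI)
      fix h assume "h \<in> M"
      then obtain t where t: "h = q * t" "1 \<le> q * t" "q * t \<le> 2 * R" by (auto simp: M_def dvd_def)
      then have "t \<in> {1..n}" using iff[of t] by (cases "t = 0") simp_all
      with t show "h \<in> (\<lambda>t. q * t) ` {1..n}" by blast
    next
      fix h assume "h \<in> (\<lambda>t. q * t) ` {1..n}"
      then obtain t where t: "h = q * t" "t \<in> {1..n}" by blast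
      then show "h \<in> M" using iff[of t] assms by (simp add: M_def Suc_le_eq)
    qed
    moreover have "inj_on (\<lambda>t. q * t) {1..n}" using assms by (simp add: inj_on_def)
    ultimately show ?thesis by (simp only: sum.reindex o_def)
  qed
  also have "\<dots> = (\<Sum>t=1..n. 6 * real R * (1 + K) powr (- 4 / 5) *
      (real q / (2 * real R)) powr (- 4 / 5) * real t powr (- 4 / 5))"
  proof (rule sum.cong[OF refl])
    fix t
    have "(real (q * t) / (2 * real R)) * (1 + K) = (1 + K) * ((real q / (2 * real R)) * real t)" by simp
    then show "6 * real R * ((real (q * t) / (2 * real R)) * (1 + K)) powr (- 4 / 5) =
       6 * real R * (1 + K) powr (- 4 / 5) *
      (real q / (2 * real R)) powr (- 4 / 5) * real t powr (- 4 / 5)"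
      using K0 by (simp only: powr_mult mult.assoc)
  qed
  also have "\<dots> = 6 * real R * (1 + K) powr (- 4 / 5) *
      (real q / (2 * real R)) powr (- 4 / 5) * (\<Sum>t=1..n. real t powr (- 4 / 5))"
    by (simp only: sum_distrib_left)
  also have "\<dots> \<le> 6 * real R * (1 + K) powr (- 4 / 5) *
      (real q / (2 * real R)) powr (- 4 / 5) * (5 * (2 * real R / real q) powr (1 / 5))"
    by (intro mult_left_mono order_trans[OF sum_powr_le]) (auto intro!: powr_mono2 nq)
  also have "\<dots> = 60 * ((real R)\<^sup>2 / real q) * (1 + K) powr (- 4 / 5)"
  proof -
    have "(real q / (2 * real R)) powr (- 4 / 5) = (2 * real R / real q) powr (4 / 5)"
      using assms by (simp add: powr_divide powr_minus)
    then have "(real q / (2 * real R)) powr (- 4 / 5) * (2 * real R / real q) powr (1 / 5) =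
        (2 * real R / real q) powr (4 / 5 + 1 / 5)" by (simp only: powr_add)
    also have "\<dots> = 2 * real R / real q" by simp
    finally have eq: "(real q / (2 * real R)) powr (- 4 / 5) * (2 * real R / real q) powr (1 / 5) =
      2 * real R / real q" .
    have "6 * real R * (1 + K) powr (- 4 / 5) *
      (real q / (2 * real R)) powr (- 4 / 5) * (5 * (2 * real R / real q) powr (1 / 5)) =
      30 * real R * (1 + K) powr (- 4 / 5) *
      ((real q / (2 * real R)) powr (- 4 / 5) * (2 * real R / real q) powr (1 / 5))" by simp
    also have "\<dots> = 60 * ((real R)\<^sup>2 / real q) * (1 + K) powr (- 4 / 5)"
      unfolding eq by (simp add: power2_eq_square)
    finally show ?thesis .
  qed
  finally have sumM: "sum W M \<le> 60 * ((real R)\<^sup>2 / real q) * (1 + K) powr (- 4 / 5)" .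

  \<comment> \<open>One extra block, so that the $T$ blocks of length $q$ cover $0, \ldots, 2R$.\<close>
  define T where "T = n + 1"
  have "2 * R < T * q" using dividend_less_div_times[OF \<open>q > 0\<close>, of "2 * R"]
    by (simp add: T_def n_def)
  then have sub: "{1..2*R} - M \<subseteq> {..<T * q}" by auto
  have "sum W ({1..2*R} - M) \<le>
      (\<Sum>h\<in>{1..2*R} - M. 6 * real R * (real R * int_dist (of_int a * real h / real q)) powr (- 4 / 5))"
    by (intro sum_mono minor) (auto simp: M_def)
  also have "\<dots> \<le> (\<Sum>h<T * q. 6 * real R * (real R * int_dist (of_int a * real h / real q)) powr (- 4 / 5))"
    by (intro sum_mono2 sub) auto
  also have "\<dots> = 6 * real R * real R powr (- 4 / 5) *
      (\<Sum>h<T * q. int_dist (of_int a * real h / real q) powr (- 4 / 5))"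
    by (simp add: powr_mult sum_distrib_left mult.assoc int_dist_def)
  also have "\<dots> \<le> 6 * real R * real R powr (- 4 / 5) * (10 * real q * real T)"
    by (intro mult_left_mono sum_int_dist_multiples_le assms) auto
  also have "\<dots> \<le> 6 * real R * real R powr (- 4 / 5) * (60 * real R)"
  proof (intro mult_left_mono)
    have "real q * real T = real q * real n + real q" by (simp add: T_def algebra_simps)
    also have "\<dots> \<le> 2 * real R + 4 * real R"
      using nq assms by (intro add_mono) (simp_all add: field_simps)
    finally show "10 * real q * real T \<le> 60 * real R" by (simp add: mult_ac)
  qed auto
  also have "\<dots> = 360 * real R powr (6 / 5)"
  proof -
    have "real R powr (6 / 5) = real R powr (1 + 1 + - 4 / 5)" by simp
    also have "\<dots> = real R * real R * real R powr (- 4 / 5)" by (simp only: powr_add powr_one of_nat_0_le_iff)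
    finally show ?thesis by simp
  qed
  finally have sumM': "sum W ({1..2*R} - M) \<le> 360 * real R powr (6 / 5)" .
  have "(\<Sum>h=1..2*R. W h) = sum W ({1..2*R} - M) + sum W M"
    by (rule sum.subset_diff) (auto simp: M_def)
  with sumM sumM' show ?thesis by (simp add: K_def \<beta>_def)
qed

section \<open>The fifth moment of the quadratic exponential sum\<close>

text \<open>The terms $h$ and $-h$ of Weyl differencing are estimated separately by
\<open>reciprocal_distance_sum_le\<close>. The diagonal term $h = 0$ is at most $3R$ and is absorbed into $R^{6/5}$.\<close>

lemma gauss_sum_sq_le:
  fixes R q :: nat and a :: int
  assumes "R > 0" "q > 0" "q \<le> 4 * R" "coprime a (int q)"
    and "\<bar>real q * (2 * \<alpha>) - of_int a\<bar> \<le> 1 / (4 * real R)"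
  defines "K \<equiv> (real R)\<^sup>2 * \<bar>2 * \<alpha> - of_int a / real q\<bar>"
  shows "(cmod (gauss_sum R \<alpha>))\<^sup>2 \<le>
    723 * ((real R)\<^sup>2 / real q * (1 + K) powr (- 4 / 5) + real R powr (6 / 5))"
proof -
  define I where "I h = {max (- int R) (- int R - h)..min (int R) (int R - h)}" for h
  define W where "W h = cmod (\<Sum>y\<in>I h. cis (2 * pi * (2 * \<alpha> * of_int h) * of_int y))" for h
  define X where "X = (real R)\<^sup>2 / real q * (1 + K) powr (- 4 / 5)"
  define Y where "Y = real R powr (6 / 5)"
  have W0: "0 \<le> W h" for h by (simp add: W_def)
  have W1: "W h \<le> 3 * real R" for h
  proof -
    have "W h \<le> (\<Sum>y\<in>I h. 1)" unfolding W_def by (rule sum_norm_le) simp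
    also have "\<dots> \<le> 2 * real R + 1" by (simp add: I_def)
    finally show ?thesis using \<open>R > 0\<close> by linarith
  qed
  have W2: "W h * (2 * int_dist (2 * \<alpha> * of_int h)) \<le> 1" for h
    unfolding W_def I_def by (rule geometric_cis_sum_le)
  have "(\<Sum>h=1..2*R. W (int h)) \<le> 60 * X + 360 * Y"
    using reciprocal_distance_sum_le[OF assms(1-5), of "\<lambda>h. W (int h)", OF W0 W1] W2[of "int _"]
    by (simp add: X_def Y_def K_def mult.assoc)
  moreover have "(\<Sum>h=1..2*R. W (- int h)) \<le> 60 * X + 360 * Y"
    using reciprocal_distance_sum_le[OF assms(1-5), of "\<lambda>h. W (- int h)", OF W0 W1] W2[of "- int _"]
    by (simp add: X_def Y_def K_def mult.assoc)
  moreover have "(\<Sum>h\<in>{- 2 * int R..2 * int R}. W h) =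
      W 0 + (\<Sum>h=1..2*R. W (int h)) + (\<Sum>h=1..2*R. W (- int h))"
  proof -
    have "{- 2 * int R..2 * int R} = insert 0 (int ` {1..2*R} \<union> (\<lambda>h. - int h) ` {1..2*R})"
    proof (intro equalityI subsetI)
      fix h assume h: "h \<in> {- 2 * int R..2 * int R}"
      consider "h = 0" | "h > 0" | "h < 0" by linarith
      then show "h \<in> insert 0 (int ` {1..2*R} \<union> (\<lambda>h. - int h) ` {1..2*R})"
      proof cases
        case 2
        then have "h = int (nat h)" "nat h \<in> {1..2*R}" using h by auto
        then show ?thesis by blast
      next
        case 3
        then have "h = - int (nat (- h))" "nat (- h) \<in> {1..2*R}" using h by auto
        then show ?thesis by blast
      qed simp
    qed auto
    moreover have "0 \<notin> int ` {1..2*R} \<union> (\<lambda>h. - int h) ` {1..2*R}" by auto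
    moreover have "int ` {1..2*R} \<inter> (\<lambda>h. - int h) ` {1..2*R} = {}" by auto
    moreover have "inj_on int {1..2*R}" "inj_on (\<lambda>h. - int h) {1..2*R}" by (auto simp: inj_on_def)
    ultimately show ?thesis
      by (simp only: sum.insert sum.union_disjoint sum.reindex finite_UnI finite_imageI
          finite_atLeastAtMost o_def add.assoc not_False_eq_True)
  qed
  moreover have "real R \<le> Y"
    using assms powr_mono[of 1 "6 / 5" "real R"] by (simp add: Y_def)
  moreover have "X \<ge> 0" by (simp add: X_def)
  ultimately have "(\<Sum>h\<in>{- 2 * int R..2 * int R}. W h) \<le> 723 * X + 723 * Y"
    using W1[of 0] by linarith
  then show ?thesis
    using weyl_differencing[of R \<alpha>] by (simp add: W_def I_def X_def Y_def distrib_left)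
qed

text \<open>The Cauchy (Lorentz) profile of width $R^{-2}$ around $2\alpha = c$. It dominates the decay $(1 + K)^{-2}$
with $K = R^2 |2\alpha - c|$ and has an elementary antiderivative.\<close>

definition lorentz :: "nat \<Rightarrow> real \<Rightarrow> real \<Rightarrow> real"
  where "lorentz R c \<alpha> = 1 / (1 + ((real R)\<^sup>2 * (2 * \<alpha> - c))\<^sup>2)"

lemma gauss_sum_power5_le:
  fixes R q :: nat and a :: int
  assumes "R > 0" "q > 0" "q \<le> 4 * R" "coprime a (int q)"
    and "\<bar>real q * (2 * \<alpha>) - of_int a\<bar> \<le> 1 / (4 * real R)"
  shows "cmod (gauss_sum R \<alpha>) ^ 5 \<le>
    1446 powr (5 / 2) * (real R ^ 5 * real q powr (- 5 / 2) * lorentz R (of_int a / real q) \<alpha> + real R ^ 3)"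
proof -
  define K where "K = (real R)\<^sup>2 * \<bar>2 * \<alpha> - of_int a / real q\<bar>"
  define X where "X = (real R)\<^sup>2 / real q * (1 + K) powr (- 4 / 5)"
  define Y where "Y = real R powr (6 / 5)"
  have nn: "K \<ge> 0" "X \<ge> 0" "Y \<ge> 0" by (auto simp: K_def X_def Y_def)
  have "(cmod (gauss_sum R \<alpha>))\<^sup>2 \<le> 723 * (X + Y)"
    using gauss_sum_sq_le[OF assms] by (simp add: K_def X_def Y_def)
  also have "X + Y \<le> 2 * max X Y" by (simp add: max_def)
  finally have sq: "(cmod (gauss_sum R \<alpha>))\<^sup>2 \<le> 1446 * max X Y" by simp
  have "cmod (gauss_sum R \<alpha>) ^ 5 = ((cmod (gauss_sum R \<alpha>))\<^sup>2) powr (5 / 2)"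
  proof (cases "gauss_sum R \<alpha> = 0")
    case False
    then have "((cmod (gauss_sum R \<alpha>))\<^sup>2) powr (5 / 2) = cmod (gauss_sum R \<alpha>) powr real 5"
      by (simp add: powr_powr flip: powr_numeral)
    then show ?thesis using False powr_realpow[of "cmod (gauss_sum R \<alpha>)" 5] by simp
  qed simp
  also have "\<dots> \<le> (1446 * max X Y) powr (5 / 2)"
    using sq by (intro powr_mono2) auto
  also have "\<dots> = 1446 powr (5 / 2) * max X Y powr (5 / 2)"
    using nn by (simp add: powr_mult)
  also have "\<dots> \<le> 1446 powr (5 / 2) * (X powr (5 / 2) + Y powr (5 / 2))"
    by (intro mult_left_mono) (auto simp: max_def)
  also have "Y powr (5 / 2) = real R ^ 3"
    using assms by (simp add: Y_def powr_powr flip: powr_numeral)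
  also have "X powr (5 / 2) \<le> real R ^ 5 * real q powr (- 5 / 2) * lorentz R (of_int a / real q) \<alpha>"
  proof -
    have "X powr (5 / 2) = ((real R)\<^sup>2) powr (5 / 2) * real q powr (- 5 / 2) * ((1 + K) powr (- 4 / 5)) powr (5 / 2)"
      using nn by (simp add: X_def powr_mult powr_divide powr_minus_divide)
    also have "((real R)\<^sup>2) powr (5 / 2) = real R ^ 5"
      using assms by (simp add: powr_powr flip: powr_numeral)
    also have "((1 + K) powr (- 4 / 5)) powr (5 / 2) = (1 + K) powr (- 2)"
      by (simp only: powr_powr) simp
    also have "\<dots> = 1 / (1 + K)\<^sup>2"
      using nn by (simp add: powr_minus_divide)
    also have "1 / (1 + K)\<^sup>2 \<le> lorentz R (of_int a / real q) \<alpha>"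
    proof -
      have "((real R)\<^sup>2 * (2 * \<alpha> - of_int a / real q))\<^sup>2 = K\<^sup>2"
        by (simp add: K_def power_mult_distrib)
      moreover have "1 + K\<^sup>2 \<le> (1 + K)\<^sup>2" "0 < 1 + K\<^sup>2" using nn by (simp_all add: power2_sum add_pos_nonneg)
      ultimately show ?thesis by (simp add: lorentz_def frac_le)
    qed
    finally show ?thesis by (simp add: mult_left_mono)
  qed
  finally show ?thesis by simp
qed

text \<open>Dirichlet's theorem supplies an admissible fraction for every $\alpha$. Summing over all fractions
gives a majorant that does not depend on the choice of the fraction, hence can be integrated term by
term. Numerators up to $2q$ occur because it is $2\alpha \in [0, 2]$ that is approximated.\<close>

lemma gauss_sum_power5_le_sum:
  assumes "R > 0" "\<alpha> \<in> {0..1}"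
  shows "cmod (gauss_sum R \<alpha>) ^ 5 \<le> 1446 powr (5 / 2) *
    ((\<Sum>q=1..4*R. \<Sum>a=0..2*q. real R ^ 5 * real q powr (- 5 / 2) * lorentz R (real a / real q) \<alpha>) + real R ^ 3)"
proof -
  obtain h k where hk: "coprime h k" "0 < k" "k \<le> int (4 * R)"
      "\<bar>of_int k * (2 * \<alpha>) - of_int h\<bar> < 1 / real (4 * R)"
    using Dirichlet_approx_coprime[of "4 * R" "2 * \<alpha>"] assms by auto
  define q where "q = nat k"
  have q: "k = int q" "q > 0" "q \<le> 4 * R" using hk by (auto simp: q_def)
  have near: "\<bar>real q * (2 * \<alpha>) - of_int h\<bar> < 1"
  proof -
    have "1 / real (4 * R) \<le> 1" using assms by simp
    with hk(4) show ?thesis by (simp only: q(1) of_int_of_nat_eq)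
  qed
  define z where "z = real q * (2 * \<alpha>)"
  have "0 \<le> z" "z \<le> 2 * real q"
    using assms mult_right_mono[of \<alpha> 1 "real q"] by (simp_all add: z_def)
  with near have "real_of_int (- 1) < of_int h" "real_of_int h < of_int (2 * int q + 1)"
    unfolding z_def[symmetric] by simp_all
  then have "- 1 < h" "h < 2 * int q + 1" by (simp_all only: of_int_less_iff)
  define a where "a = nat h"
  have a: "h = int a" "a \<le> 2 * q" using \<open>- 1 < h\<close> \<open>h < 2 * int q + 1\<close> by (simp_all add: a_def)
  let ?f = "\<lambda>q a. real R ^ 5 * real q powr (- 5 / 2) * lorentz R (real a / real q) \<alpha>"
  have nn: "?f q a \<ge> 0" for q a by (simp add: lorentz_def)
  have "?f q a \<le> (\<Sum>a=0..2*q. ?f q a)"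
    using a nn by (intro member_le_sum) auto
  also have "\<dots> \<le> (\<Sum>q=1..4*R. \<Sum>a=0..2*q. ?f q a)"
    using q nn by (intro member_le_sum[of q "{1..4*R}" "\<lambda>q. \<Sum>a=0..2*q. ?f q a"] sum_nonneg) auto
  finally have "?f q a \<le> (\<Sum>q=1..4*R. \<Sum>a=0..2*q. ?f q a)" .
  moreover have "cmod (gauss_sum R \<alpha>) ^ 5 \<le> 1446 powr (5 / 2) * (?f q a + real R ^ 3)"
    using gauss_sum_power5_le[of R q "int a" \<alpha>] assms hk q a by simp
  ultimately show ?thesis
    by (smt (verit) mult_left_mono powr_ge_zero)
qed

lemma lorentz_integral:
  assumes "R > 0"
  shows "lorentz R c integrable_on {0..1}" "integral {0..1} (lorentz R c) \<le> pi / (2 * (real R)\<^sup>2)"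
proof -
  define K where "K = (real R)\<^sup>2"
  have K: "K > 0" using assms by (simp add: K_def)
  define F where "F x = arctan (K * (2 * x - c)) / (2 * K)" for x
  have pos: "1 + (K * (2 * x - c))\<^sup>2 \<noteq> 0" for x by (smt (verit) zero_le_power2)
  have "(F has_real_derivative lorentz R c x) (at x within {0..1})" for x
    unfolding F_def lorentz_def K_def[symmetric]
    by (auto intro!: derivative_eq_intros simp: divide_simps pos K less_imp_neq[OF K, symmetric])
  then have hi: "(lorentz R c has_integral F 1 - F 0) {0..1}"
    by (intro fundamental_theorem_of_calculus)
       (auto simp flip: has_real_derivative_iff_has_vector_derivative)
  then show "lorentz R c integrable_on {0..1}" by blast
  have "integral {0..1} (lorentz R c) = (arctan (K * (2 - c)) - arctan (K * (- c))) / (2 * K)"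
    using integral_unique[OF hi] by (simp add: F_def diff_divide_distrib)
  also have "\<dots> \<le> pi / (2 * K)"
    using arctan_bounded[of "K * (2 - c)"] arctan_bounded[of "K * (- c)"] K
    by (intro divide_right_mono) auto
  finally show "integral {0..1} (lorentz R c) \<le> pi / (2 * (real R)\<^sup>2)" by (simp add: K_def)
qed

lemma continuous_gauss_sum: "continuous_on A (gauss_sum R)"
  unfolding gauss_sum_def[abs_def] by (intro continuous_intros)

text \<open>Each fraction $a/q$ contributes $R^5 q^{-5/2}$ times the integral $O(R^{-2})$ of a Lorentz profile. With at
most $3q$ numerators per denominator this sums to $R^3 \sum_q q^{-3/2}$. Convergence of this series is
where the number 5 of variables enters.\<close>

lemma gauss_sum_fifth_moment:
  "\<exists>C\<ge>0. \<forall>R>0. integral {0..1} (\<lambda>\<alpha>. cmod (gauss_sum R \<alpha>) ^ 5) \<le> C * real R ^ 3"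
proof -
  define Z where "Z = (\<Sum>q. real q powr (- 3 / 2))"
  have summ: "summable (\<lambda>q. real q powr (- 3 / 2))" by (simp add: summable_real_powr_iff)
  have Z0: "Z \<ge> 0" unfolding Z_def by (intro suminf_nonneg summ) auto
  define C where "C = 1446 powr (5 / 2) * (3 * pi / 2 * Z + 1)"
  have "integral {0..1} (\<lambda>\<alpha>. cmod (gauss_sum R \<alpha>) ^ 5) \<le> C * real R ^ 3" if R: "R > 0" for R
  proof -
    let ?g = "\<lambda>q a \<alpha>. real R ^ 5 * real q powr (- 5 / 2) * lorentz R (real a / real q) \<alpha>"
    let ?G = "\<lambda>\<alpha>. 1446 powr (5 / 2) * ((\<Sum>q=1..4*R. \<Sum>a=0..2*q. ?g q a \<alpha>) + real R ^ 3)"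
    note [intro] = lorentz_integral(1)[OF R]
    have int_g: "?g q a integrable_on {0..1}" for q a
      by (intro integrable_on_mult_right) auto
    have int_G: "?G integrable_on {0..1}"
      by (intro integrable_on_mult_right integrable_add integrable_sum int_g) auto
    have le_g: "integral {0..1} (?g q a) \<le> real R ^ 3 * (pi / 2) * real q powr (- 5 / 2)" for q a
    proof -
      have "integral {0..1} (?g q a) = real R ^ 5 * real q powr (- 5 / 2) * integral {0..1} (lorentz R (real a / real q))"
        by simp
      also have "\<dots> \<le> real R ^ 5 * real q powr (- 5 / 2) * (pi / (2 * (real R)\<^sup>2))"
        by (intro mult_left_mono lorentz_integral R) auto
      also have "\<dots> = real R ^ 3 * (pi / 2) * real q powr (- 5 / 2)"
        using R by (simp add: field_simps eval_nat_numeral)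
      finally show ?thesis .
    qed
    have "integral {0..1} (\<lambda>\<alpha>. cmod (gauss_sum R \<alpha>) ^ 5) \<le> integral {0..1} ?G"
      using gauss_sum_power5_le_sum[OF R]
      by (intro integral_le int_G integrable_continuous_interval continuous_intros continuous_gauss_sum)
    also have "\<dots> = 1446 powr (5 / 2) * ((\<Sum>q=1..4*R. \<Sum>a=0..2*q. integral {0..1} (?g q a)) + real R ^ 3)"
    proof -
      have "integral {0..1} (\<lambda>\<alpha>. (\<Sum>q=1..4*R. \<Sum>a=0..2*q. ?g q a \<alpha>) + real R ^ 3) =
        integral {0..1} (\<lambda>\<alpha>. \<Sum>q=1..4*R. \<Sum>a=0..2*q. ?g q a \<alpha>) + integral {0..1} (\<lambda>_::real. real R ^ 3)"
        by (intro integral_add integrable_sum int_g) auto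
      also have "integral {0..1} (\<lambda>\<alpha>. \<Sum>q=1..4*R. \<Sum>a=0..2*q. ?g q a \<alpha>) =
          (\<Sum>q=1..4*R. \<Sum>a=0..2*q. integral {0..1} (?g q a))"
      proof -
        have "integral {0..1} (\<lambda>\<alpha>. \<Sum>q=1..4*R. \<Sum>a=0..2*q. ?g q a \<alpha>) =
            (\<Sum>q=1..4*R. integral {0..1} (\<lambda>\<alpha>. \<Sum>a=0..2*q. ?g q a \<alpha>))"
          by (intro integral_sum integrable_sum int_g) auto
        also have "\<dots> = (\<Sum>q=1..4*R. \<Sum>a=0..2*q. integral {0..1} (?g q a))"
          by (intro sum.cong refl integral_sum int_g) auto
        finally show ?thesis .
      qed
      finally show ?thesis by (simp only: integral_mult_right) simp
    qed
    also have "\<dots> \<le> 1446 powr (5 / 2) * ((real R ^ 3 * (3 * pi / 2) * Z) + real R ^ 3)"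
    proof (intro mult_left_mono add_right_mono)
      have "(\<Sum>q=1..4*R. \<Sum>a=0..2*q. integral {0..1} (?g q a)) \<le>
          (\<Sum>q=1..4*R. real R ^ 3 * (3 * pi / 2) * real q powr (- 3 / 2))"
      proof (rule sum_mono)
        fix q assume q: "q \<in> {1..4*R}"
        have "(\<Sum>a=0..2*q. integral {0..1} (?g q a)) \<le>
            (\<Sum>a=0..2*q. real R ^ 3 * (pi / 2) * real q powr (- 5 / 2))"
          by (intro sum_mono le_g)
        also have "\<dots> = (2 * real q + 1) * (real R ^ 3 * (pi / 2) * real q powr (- 5 / 2))" by simp
        also have "\<dots> \<le> (3 * real q) * (real R ^ 3 * (pi / 2) * real q powr (- 5 / 2))"
          using q by (intro mult_right_mono) auto
        also have "\<dots> = real R ^ 3 * (3 * pi / 2) * (real q powr 1 * real q powr (- 5 / 2))"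
          using q by simp
        also have "real q powr 1 * real q powr (- 5 / 2) = real q powr (- 3 / 2)"
          by (simp only: powr_add[symmetric]) simp
        finally show "(\<Sum>a=0..2*q. integral {0..1} (?g q a)) \<le> real R ^ 3 * (3 * pi / 2) * real q powr (- 3 / 2)" .
      qed
      also have "\<dots> = real R ^ 3 * (3 * pi / 2) * (\<Sum>q=1..4*R. real q powr (- 3 / 2))"
        by (simp only: sum_distrib_left)
      also have "\<dots> \<le> real R ^ 3 * (3 * pi / 2) * Z"
        unfolding Z_def by (intro mult_left_mono sum_le_suminf summ) auto
      finally show "(\<Sum>q=1..4*R. \<Sum>a=0..2*q. integral {0..1} (?g q a)) \<le> real R ^ 3 * (3 * pi / 2) * Z" .
    qed auto
    also have "\<dots> = C * real R ^ 3" by (simp add: C_def algebra_simps)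
    finally show ?thesis .
  qed
  moreover have "C \<ge> 0" using Z0 by (simp add: C_def)
  ultimately show ?thesis by blast
qed

section \<open>Lattice points on spheres\<close>

lemma integral_cis_int:
  "((\<lambda>\<alpha>. cis (2 * pi * \<alpha> * of_int k)) has_integral (if k = 0 then 1 else 0)) {0..1}"
proof (cases "k = 0")
  case True
  then show ?thesis using has_integral_const_real[of "1 :: complex" 0 1] by simp
next
  case False
  define c :: complex where "c = \<i> * of_real (2 * pi * of_int k)"
  have c: "c \<noteq> 0" using False by (simp add: c_def)
  have eq: "cis (2 * pi * \<alpha> * of_int k) = exp (c * of_real \<alpha>)" for \<alpha>
    by (simp add: cis_conv_exp c_def mult_ac)
  have "((\<lambda>x. exp (c * x) / c) has_vector_derivative exp (c * t)) (at t within {0..1})" for t :: real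
    using c by (intro derivative_eq_intros has_complex_derivative_imp_has_vector_derivative [unfolded o_def] | simp)+
  then have "((\<lambda>t. exp (c * of_real t)) has_integral exp (c * of_real 1) / c - exp (c * of_real 0) / c) {0..1}"
    by (intro fundamental_theorem_of_calculus) auto
  moreover have "exp (c * of_real 1) = 1"
  proof -
    have "exp (c * of_real 1) = cis (2 * pi * of_int k)" by (simp add: cis_conv_exp c_def)
    also have "\<dots> = 1" by (rule cis_multiple_2pi) simp
    finally show ?thesis .
  qed
  ultimately show ?thesis using False by (simp add: eq)
qed

lemma prod_cis: "finite A \<Longrightarrow> (\<Prod>i\<in>A. cis (f i)) = cis (\<Sum>i\<in>A. f i)"
  by (induction A rule: finite_induct) (auto simp: cis_mult)

lemma abs_component_le_of_norm_sq:
  fixes v :: "int ^ 'd::finite"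
  assumes "norm_sq v \<le> (int R)\<^sup>2"
  shows "\<bar>v $ i\<bar> \<le> int R"
proof -
  have "(v $ i)\<^sup>2 \<le> norm_sq v" unfolding norm_sq_def by (rule member_le_sum) auto
  with assms have "\<bar>v $ i\<bar>\<^sup>2 \<le> (int R)\<^sup>2" by simp
  then show ?thesis by (rule power2_le_imp_le) simp
qed

lemma lattice_box_eq_image:
  "(lattice_box N :: (int ^ 'd::finite) set) = vec_lambda ` (UNIV \<rightarrow>\<^sub>E {- int N..int N})"
proof (intro equalityI subsetI)
  fix x :: "int ^ 'd"
  assume "x \<in> lattice_box N"
  then have "vec_nth x \<in> UNIV \<rightarrow>\<^sub>E {- int N..int N}" by (auto simp: lattice_box_def abs_le_iff minus_le_iff)
  then have "vec_lambda (vec_nth x) \<in> vec_lambda ` (UNIV \<rightarrow>\<^sub>E {- int N..int N})" by (rule imageI)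
  then show "x \<in> vec_lambda ` (UNIV \<rightarrow>\<^sub>E {- int N..int N})" by simp
next
  fix x :: "int ^ 'd"
  assume "x \<in> vec_lambda ` (UNIV \<rightarrow>\<^sub>E {- int N..int N})"
  then obtain g where g: "x = vec_lambda g" "g \<in> UNIV \<rightarrow>\<^sub>E {- int N..int N}" by blast
  have "\<bar>g i\<bar> \<le> int N" for i using PiE_mem[OF g(2), of i] by (simp add: abs_le_iff minus_le_iff)
  then show "x \<in> lattice_box N" by (simp add: lattice_box_def g(1))
qed

lemma finite_lattice_box: "finite (lattice_box N)"
  unfolding lattice_box_eq_image by (intro finite_imageI finite_PiE) auto

lemma inj_vec_lambda: "inj_on vec_lambda A"
  by (metis inj_onI vec_lambda_inject UNIV_I)

lemma card_lattice_box: "card (lattice_box N :: (int ^ 'd::finite) set) = (2 * N + 1) ^ CARD('d)"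
proof -
  have "card (lattice_box N :: (int ^ 'd) set) = card ((UNIV :: 'd set) \<rightarrow>\<^sub>E {- int N..int N})"
    unfolding lattice_box_eq_image by (rule card_image[OF inj_vec_lambda])
  also have "\<dots> = (2 * N + 1) ^ CARD('d)" by (simp add: card_PiE nat_add_distrib nat_mult_distrib)
  finally show ?thesis .
qed

lemma gauss_sum_power_card:
  "gauss_sum R \<alpha> ^ CARD('d::finite) =
    (\<Sum>x\<in>(lattice_box R :: (int ^ 'd) set). cis (2 * pi * \<alpha> * of_int (norm_sq x)))"
proof -
  let ?e = "\<lambda>y. cis (2 * pi * \<alpha> * of_int (y\<^sup>2))"
  have "gauss_sum R \<alpha> ^ CARD('d) = (\<Prod>i\<in>(UNIV :: 'd set). \<Sum>y\<in>{- int R..int R}. ?e y)"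
    by (simp add: gauss_sum_def)
  also have "\<dots> = (\<Sum>g\<in>UNIV \<rightarrow>\<^sub>E {- int R..int R}. \<Prod>i\<in>(UNIV :: 'd set). ?e (g i))"
    by (rule prod_sum_PiE) auto
  also have "\<dots> = (\<Sum>g\<in>(UNIV :: 'd set) \<rightarrow>\<^sub>E {- int R..int R}. cis (2 * pi * \<alpha> * of_int (norm_sq (vec_lambda g))))"
    by (simp add: prod_cis norm_sq_def sum_distrib_left)
  also have "\<dots> = (\<Sum>x\<in>(lattice_box R :: (int ^ 'd) set). cis (2 * pi * \<alpha> * of_int (norm_sq x)))"
    unfolding lattice_box_eq_image by (simp add: sum.reindex[OF inj_vec_lambda])
  finally show ?thesis .
qed

lemma lattice_sphere_subset_box:
  assumes "m \<le> (int R)\<^sup>2"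
  shows "lattice_sphere m \<subseteq> lattice_box R"
  using assms abs_component_le_of_norm_sq by (auto simp: lattice_sphere_def lattice_box_def)

lemma finite_lattice_sphere: "finite (lattice_sphere m)"
proof -
  have "m \<le> (int (nat m))\<^sup>2"
    by (cases "m \<ge> 1") (auto simp: power2_eq_square mult_le_cancel_left1 intro: order_trans[of _ 0])
  then show ?thesis by (meson finite_lattice_box finite_subset lattice_sphere_subset_box)
qed

text \<open>Orthogonality of the characters $e(k\alpha)$ picks out the points of the box with squared norm $m$, and
the box contains the whole sphere.\<close>

lemma card_lattice_sphere_le_integral:
  assumes "m \<le> (int R)\<^sup>2"
  shows "real (card (lattice_sphere m :: (int ^ 'd::finite) set)) \<le>
    integral {0..1} (\<lambda>\<alpha>. cmod (gauss_sum R \<alpha>) ^ CARD('d))"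
proof -
  let ?B = "lattice_box R :: (int ^ 'd) set"
  let ?f = "\<lambda>\<alpha>. gauss_sum R \<alpha> ^ CARD('d) * cis (2 * pi * \<alpha> * of_int (- m))"
  have "?f = (\<lambda>\<alpha>. \<Sum>x\<in>?B. cis (2 * pi * \<alpha> * of_int (norm_sq x - m)))"
  proof
    fix \<alpha>
    have "cis (2 * pi * \<alpha> * of_int (norm_sq x)) * cis (2 * pi * \<alpha> * of_int (- m)) =
        cis (2 * pi * \<alpha> * of_int (norm_sq x - m))" for x :: "int ^ 'd"
      by (simp add: cis_mult algebra_simps)
    then show "?f \<alpha> = (\<Sum>x\<in>?B. cis (2 * pi * \<alpha> * of_int (norm_sq x - m)))"
      by (simp only: gauss_sum_power_card sum_distrib_right)
  qed
  then have "(?f has_integral (\<Sum>x\<in>?B. if norm_sq x - m = 0 then 1 else 0)) {0..1}"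
    by (simp only:) (intro has_integral_sum finite_lattice_box integral_cis_int)
  moreover have "(\<Sum>x\<in>?B. if norm_sq x - m = 0 then 1 else 0) =
      (of_nat (card (lattice_sphere m :: (int ^ 'd) set)) :: complex)"
  proof -
    have "lattice_sphere m = {x\<in>?B. norm_sq x - m = 0}"
      using lattice_sphere_subset_box[OF assms] by (auto simp: lattice_sphere_def)
    then show ?thesis by (simp add: sum.If_cases finite_lattice_box Int_def)
  qed
  ultimately have hi: "(?f has_integral of_nat (card (lattice_sphere m :: (int ^ 'd) set))) {0..1}"
    by simp
  have "norm (integral {0..1} ?f) \<le> integral {0..1} (\<lambda>\<alpha>. cmod (gauss_sum R \<alpha>) ^ CARD('d))"
    using hi by (intro integral_norm_bound_integral integrable_continuous_interval
      continuous_intros continuous_gauss_sum) (auto simp: norm_mult norm_power)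
  then show ?thesis using integral_unique[OF hi] by simp
qed

lemma norm_gauss_sum_le: "R > 0 \<Longrightarrow> cmod (gauss_sum R \<alpha>) \<le> 3 * real R"
proof -
  assume "R > 0"
  have "cmod (gauss_sum R \<alpha>) \<le> (\<Sum>x\<in>{- int R..int R}. 1)"
    unfolding gauss_sum_def by (rule sum_norm_le) simp
  also have "\<dots> \<le> 3 * real R" using \<open>R > 0\<close> by simp
  finally show ?thesis .
qed

text \<open>Five of the $d$ factors are used for the fifth moment, the others are estimated trivially by $3R$.
Together this is $O(R^{d-5} R^3) = O(R^{d-2})$ with $R$ of order $\sqrt m$.\<close>

theorem card_lattice_sphere_le:
  assumes "CARD('d::finite) \<ge> 5"
  shows "\<exists>C\<ge>0. \<forall>m>0. real (card (lattice_sphere m :: (int ^ 'd) set))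
    \<le> C * real_of_int m powr ((real CARD('d) - 2) / 2)"
proof -
  let ?d = "CARD('d)"
  obtain C where C: "C \<ge> 0" "\<And>R. R > 0 \<Longrightarrow>
      integral {0..1} (\<lambda>\<alpha>. cmod (gauss_sum R \<alpha>) ^ 5) \<le> C * real R ^ 3"
    using gauss_sum_fifth_moment by blast
  define C' where "C' = 3 ^ (?d - 5) * C * 2 ^ (?d - 2)"
  have "real (card (lattice_sphere m :: (int ^ 'd) set)) \<le> C' * real_of_int m powr ((real ?d - 2) / 2)"
    if m: "m > 0" for m
  proof -
    define R where "R = nat \<lceil>sqrt (real_of_int m)\<rceil>"
    have s1: "sqrt (real_of_int m) \<ge> 1" using m by simp
    have Rge: "sqrt (real_of_int m) \<le> real R" unfolding R_def by linarith
    have Rle: "real R \<le> 2 * sqrt (real_of_int m)" unfolding R_def using s1 by linarith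
    have R0: "R > 0" using Rge s1 by (cases R) auto
    have "real_of_int m = (sqrt (real_of_int m))\<^sup>2" using m by simp
    also have "\<dots> \<le> (real R)\<^sup>2" using Rge s1 by (intro power_mono) auto
    finally have "real_of_int m \<le> real_of_int ((int R)\<^sup>2)" by simp
    then have mR: "m \<le> (int R)\<^sup>2" by (simp only: of_int_le_iff)
    have "real (card (lattice_sphere m :: (int ^ 'd) set)) \<le>
        integral {0..1} (\<lambda>\<alpha>. cmod (gauss_sum R \<alpha>) ^ ?d)"
      by (rule card_lattice_sphere_le_integral[OF mR])
    also have "\<dots> \<le> integral {0..1} (\<lambda>\<alpha>. (3 * real R) ^ (?d - 5) * cmod (gauss_sum R \<alpha>) ^ 5)"
    proof (intro integral_le integrable_continuous_interval continuous_intros continuous_gauss_sum)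
      fix \<alpha>
      have "cmod (gauss_sum R \<alpha>) ^ ?d = cmod (gauss_sum R \<alpha>) ^ (?d - 5) * cmod (gauss_sum R \<alpha>) ^ 5"
        using assms by (simp flip: power_add)
      also have "\<dots> \<le> (3 * real R) ^ (?d - 5) * cmod (gauss_sum R \<alpha>) ^ 5"
        by (intro mult_right_mono power_mono norm_gauss_sum_le R0) auto
      finally show "cmod (gauss_sum R \<alpha>) ^ ?d \<le> (3 * real R) ^ (?d - 5) * cmod (gauss_sum R \<alpha>) ^ 5" .
    qed
    also have "\<dots> = (3 * real R) ^ (?d - 5) * integral {0..1} (\<lambda>\<alpha>. cmod (gauss_sum R \<alpha>) ^ 5)"
      by (rule integral_mult_right)
    also have "\<dots> \<le> (3 * real R) ^ (?d - 5) * (C * real R ^ 3)"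
      by (intro mult_left_mono C R0) auto
    also have "\<dots> = 3 ^ (?d - 5) * C * real R ^ (?d - 2)"
    proof -
      have "?d - 2 = (?d - 5) + 3" using assms by simp
      then have "real R ^ (?d - 2) = real R ^ (?d - 5) * real R ^ 3" by (simp only: power_add)
      then show ?thesis by (simp only: power_mult_distrib mult_ac)
    qed
    also have "\<dots> \<le> 3 ^ (?d - 5) * C * (2 * sqrt (real_of_int m)) ^ (?d - 2)"
      using C by (intro mult_left_mono power_mono Rle) auto
    also have "\<dots> = C' * sqrt (real_of_int m) ^ (?d - 2)"
      by (simp add: C'_def power_mult_distrib)
    also have "sqrt (real_of_int m) ^ (?d - 2) = real_of_int m powr ((real ?d - 2) / 2)"
    proof -
      have "sqrt (real_of_int m) ^ (?d - 2) = (real_of_int m powr (1 / 2)) powr real (?d - 2)"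
        using m by (simp add: powr_half_sqrt powr_realpow)
      also have "\<dots> = real_of_int m powr ((real ?d - 2) / 2)"
        using assms by (simp add: powr_powr of_nat_diff)
      finally show ?thesis .
    qed
    finally show ?thesis .
  qed
  moreover have "C' \<ge> 0" using C by (simp add: C'_def)
  ultimately show ?thesis by blast
qed

section \<open>Deleting points from a binomial random subset\<close>

lemma set_pmf_binomial_subset: "finite A \<Longrightarrow> set_pmf (binomial_subset A p) \<subseteq> Pow A"
  by (auto simp: binomial_subset_def)

lemma finite_set_pmf_binomial_subset: "finite A \<Longrightarrow> finite (set_pmf (binomial_subset A p))"
  by (meson finite_Pow_iff finite_subset set_pmf_binomial_subset)

lemma prob_subset_binomial_subset:
  assumes "finite A" "S \<subseteq> A" "p \<in> {0..1}"
  shows "measure_pmf.prob (binomial_subset A p) {\<Omega>. S \<subseteq> \<Omega>} = p ^ card S"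
proof -
  have "measure_pmf.prob (binomial_subset A p) {\<Omega>. S \<subseteq> \<Omega>} =
      measure_pmf.prob (Pi_pmf A False (\<lambda>_. bernoulli_pmf p)) (Pi A (\<lambda>x. if x \<in> S then {True} else UNIV))"
    unfolding binomial_subset_def measure_map_pmf
    using assms by (intro arg_cong2[where f = measure]) (auto simp: Pi_def split: if_splits)
  also have "\<dots> = (\<Prod>x\<in>A. measure_pmf.prob (bernoulli_pmf p) (if x \<in> S then {True} else UNIV))"
    by (rule measure_Pi_pmf_Pi[OF assms(1)])
  also have "\<dots> = (\<Prod>x\<in>A. if x \<in> S then p else 1)"
    using assms by (intro prod.cong) (auto simp: measure_pmf_single)
  also have "\<dots> = p ^ card S"
    using assms by (simp add: prod.If_cases Int_absorb1)
  finally show ?thesis .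
qed

lemma pmf_Markov:
  fixes u :: "'a \<Rightarrow> real"
  assumes "finite (set_pmf M)" "\<And>x. 0 \<le> u x" "0 < c"
  shows "measure_pmf.prob M {x. c \<le> u x} \<le> measure_pmf.expectation M u / c"
  using integral_Markov_inequality_measure[of M u "{}" c] assms
  by (simp add: integrable_measure_pmf_finite)

text \<open>Chebyshev's inequality: the mean of the cardinality is $\mu = p |A|$ and its variance is at most $\mu$,
because distinct points are retained independently.\<close>

lemma prob_binomial_subset_small:
  assumes "finite A" "p \<in> {0..1}" and \<mu>: "p * real (card A) > 0"
  shows "measure_pmf.prob (binomial_subset A p) {\<Omega>. real (card \<Omega>) \<le> p * real (card A) / 2}
    \<le> 4 / (p * real (card A))"
proof -
  let ?M = "binomial_subset A p"
  define n where "n = real (card A)"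
  define \<mu> where "\<mu> = p * n"
  note fin = finite_set_pmf_binomial_subset[OF assms(1), of p]
  have [simp]: "integrable ?M f" for f :: "'a set \<Rightarrow> real"
    by (rule integrable_measure_pmf_finite[OF fin])
  have card_eq: "real (card \<Omega>) = (\<Sum>x\<in>A. indicator {\<Omega>. {x} \<subseteq> \<Omega>} \<Omega>)" if "\<Omega> \<in> set_pmf ?M" for \<Omega>
  proof -
    have "\<Omega> \<subseteq> A" using that set_pmf_binomial_subset[OF assms(1)] by blast
    then show ?thesis
      using assms(1) by (simp add: indicator_def sum.If_cases Int_absorb1)
  qed
  have first: "measure_pmf.expectation ?M (\<lambda>\<Omega>. real (card \<Omega>)) = \<mu>"
  proof -
    have "measure_pmf.expectation ?M (\<lambda>\<Omega>. real (card \<Omega>)) =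
        measure_pmf.expectation ?M (\<lambda>\<Omega>. \<Sum>x\<in>A. indicator {\<Omega>. {x} \<subseteq> \<Omega>} \<Omega>)"
      by (intro integral_cong_AE) (auto simp: AE_measure_pmf_iff card_eq)
    also have "\<dots> = (\<Sum>x\<in>A. measure_pmf.prob ?M {\<Omega>. {x} \<subseteq> \<Omega>})"
      by (subst Bochner_Integration.integral_sum) simp_all
    also have "\<dots> = (\<Sum>x\<in>A. p)"
      using assms by (intro sum.cong refl) (subst prob_subset_binomial_subset, auto)
    finally show ?thesis by (simp add: \<mu>_def n_def mult.commute)
  qed
  have second: "measure_pmf.expectation ?M (\<lambda>\<Omega>. (real (card \<Omega>))\<^sup>2) \<le> \<mu>\<^sup>2 + \<mu>"
  proof -
    have "measure_pmf.expectation ?M (\<lambda>\<Omega>. (real (card \<Omega>))\<^sup>2) =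
        measure_pmf.expectation ?M (\<lambda>\<Omega>. \<Sum>x\<in>A. \<Sum>y\<in>A. indicator {\<Omega>. {x, y} \<subseteq> \<Omega>} \<Omega>)"
    proof (intro integral_cong_AE, unfold AE_measure_pmf_iff, safe)
      fix \<Omega> assume "\<Omega> \<in> set_pmf ?M"
      have ind: "indicator {\<Omega>. {x} \<subseteq> \<Omega>} \<Omega> * indicator {\<Omega>. {y} \<subseteq> \<Omega>} \<Omega> = (indicator {\<Omega>. {x, y} \<subseteq> \<Omega>} \<Omega> :: real)"
        for x y by (simp add: indicator_def)
      show "(real (card \<Omega>))\<^sup>2 = (\<Sum>x\<in>A. \<Sum>y\<in>A. indicator {\<Omega>. {x, y} \<subseteq> \<Omega>} \<Omega>)"
        unfolding card_eq[OF \<open>\<Omega> \<in> set_pmf ?M\<close>] power2_eq_square sum_product by (simp only: ind)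
    qed auto
    also have "\<dots> = (\<Sum>x\<in>A. \<Sum>y\<in>A. measure_pmf.prob ?M {\<Omega>. {x, y} \<subseteq> \<Omega>})"
      by (simp add: Bochner_Integration.integral_sum)
    also have "\<dots> \<le> (\<Sum>x\<in>A. \<Sum>y\<in>A. p\<^sup>2 + (if x = y then p else 0))"
    proof (intro sum_mono)
      fix x y assume "x \<in> A" "y \<in> A"
      then show "measure_pmf.prob ?M {\<Omega>. {x, y} \<subseteq> \<Omega>} \<le> p\<^sup>2 + (if x = y then p else 0)"
        using prob_subset_binomial_subset[OF assms(1) _ assms(2), of "{x, y}"] by (cases "x = y") (auto simp: power2_eq_square)
    qed
    also have "\<dots> = \<mu>\<^sup>2 + \<mu>"
      using assms(1) by (simp add: sum.distrib \<mu>_def n_def power2_eq_square algebra_simps)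
    finally show ?thesis .
  qed
  have var: "measure_pmf.expectation ?M (\<lambda>\<Omega>. (real (card \<Omega>) - \<mu>)\<^sup>2) \<le> \<mu>"
  proof -
    have "measure_pmf.expectation ?M (\<lambda>\<Omega>. (real (card \<Omega>) - \<mu>)\<^sup>2) =
        measure_pmf.expectation ?M (\<lambda>\<Omega>. (real (card \<Omega>))\<^sup>2 - 2 * \<mu> * real (card \<Omega>) + \<mu>\<^sup>2)"
      by (simp add: power2_diff algebra_simps)
    also have "\<dots> = measure_pmf.expectation ?M (\<lambda>\<Omega>. (real (card \<Omega>))\<^sup>2) - 2 * \<mu> * \<mu> + \<mu>\<^sup>2"
      by (simp add: first)
    finally show ?thesis using second by (simp add: power2_eq_square)
  qed
  have \<mu>0: "\<mu> > 0" using assms by (simp add: \<mu>_def n_def)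
  have "measure_pmf.prob ?M {\<Omega>. real (card \<Omega>) \<le> \<mu> / 2} \<le>
      measure_pmf.prob ?M {\<Omega>. (\<mu> / 2)\<^sup>2 \<le> (real (card \<Omega>) - \<mu>)\<^sup>2}"
  proof (intro measure_pmf.finite_measure_mono subsetI)
    fix \<Omega> assume "\<Omega> \<in> {\<Omega>. real (card \<Omega>) \<le> \<mu> / 2}"
    then have "\<mu> / 2 \<le> \<mu> - real (card \<Omega>)" by simp
    then have "(\<mu> / 2)\<^sup>2 \<le> (\<mu> - real (card \<Omega>))\<^sup>2" using \<mu>0 by (intro power_mono) auto
    then show "\<Omega> \<in> {\<Omega>. (\<mu> / 2)\<^sup>2 \<le> (real (card \<Omega>) - \<mu>)\<^sup>2}" by (simp add: power2_commute)
  qed simp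
  also have "\<dots> \<le> measure_pmf.expectation ?M (\<lambda>\<Omega>. (real (card \<Omega>) - \<mu>)\<^sup>2) / (\<mu> / 2)\<^sup>2"
    using \<mu>0 by (intro pmf_Markov fin) auto
  also have "\<dots> \<le> \<mu> / (\<mu> / 2)\<^sup>2"
    by (intro divide_right_mono var) auto
  also have "\<dots> = 4 / \<mu>" using \<mu>0 by (simp add: power2_eq_square)
  finally show ?thesis by (simp add: \<mu>_def n_def)
qed

text \<open>Every bad point is the first component of a pair in $E$ that survives, and a pair of distinct points
survives with probability $p^2$.\<close>

lemma expectation_bad_points_le:
  assumes "finite A" "p \<in> {0..1}" "E \<subseteq> A \<times> A" "\<And>x. (x, x) \<notin> E"
  shows "measure_pmf.expectation (binomial_subset A p)
      (\<lambda>\<Omega>. real (card {x\<in>\<Omega>. \<exists>y\<in>\<Omega>. (x, y) \<in> E})) \<le> real (card E) * p\<^sup>2"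
proof -
  let ?M = "binomial_subset A p"
  note fin = finite_set_pmf_binomial_subset[OF assms(1), of p]
  have finE: "finite E" using assms finite_subset by blast
  have [simp]: "integrable ?M f" for f :: "'a set \<Rightarrow> real"
    by (rule integrable_measure_pmf_finite[OF fin])
  have "measure_pmf.expectation ?M (\<lambda>\<Omega>. real (card {x\<in>\<Omega>. \<exists>y\<in>\<Omega>. (x, y) \<in> E})) \<le>
      measure_pmf.expectation ?M (\<lambda>\<Omega>. \<Sum>e\<in>E. indicator {\<Omega>. {fst e, snd e} \<subseteq> \<Omega>} \<Omega>)"
  proof (intro integral_mono)
    fix \<Omega>
    have finF: "finite {e\<in>E. {fst e, snd e} \<subseteq> \<Omega>}" using finE by simp
    have "{x\<in>\<Omega>. \<exists>y\<in>\<Omega>. (x, y) \<in> E} \<subseteq> fst ` {e\<in>E. {fst e, snd e} \<subseteq> \<Omega>}" by force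
    then have "card {x\<in>\<Omega>. \<exists>y\<in>\<Omega>. (x, y) \<in> E} \<le> card (fst ` {e\<in>E. {fst e, snd e} \<subseteq> \<Omega>})"
      by (intro card_mono finite_imageI finF)
    also have "\<dots> \<le> card {e\<in>E. {fst e, snd e} \<subseteq> \<Omega>}"
      by (rule card_image_le[OF finF])
    finally have "card {x\<in>\<Omega>. \<exists>y\<in>\<Omega>. (x, y) \<in> E} \<le> card {e\<in>E. {fst e, snd e} \<subseteq> \<Omega>}" .
    then show "real (card {x\<in>\<Omega>. \<exists>y\<in>\<Omega>. (x, y) \<in> E}) \<le> (\<Sum>e\<in>E. indicator {\<Omega>. {fst e, snd e} \<subseteq> \<Omega>} \<Omega>)"
      using finE by (simp add: indicator_def sum.If_cases Int_def)
  qed auto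
  also have "\<dots> = (\<Sum>e\<in>E. measure_pmf.prob ?M {\<Omega>. {fst e, snd e} \<subseteq> \<Omega>})"
    by (subst Bochner_Integration.integral_sum) simp_all
  also have "\<dots> = (\<Sum>e\<in>E. p\<^sup>2)"
  proof (rule sum.cong[OF refl])
    fix e assume "e \<in> E"
    with assms(3,4) have "{fst e, snd e} \<subseteq> A" "card {fst e, snd e} = 2"
      by (auto simp: card_2_iff) (metis prod.collapse)
    with assms(1,2) show "measure_pmf.prob ?M {\<Omega>. {fst e, snd e} \<subseteq> \<Omega>} = p\<^sup>2"
      by (simp only: prob_subset_binomial_subset)
  qed
  finally show ?thesis by simp
qed

text \<open>If the directed graph $E$ has at most $\eta |A| / p$ edges, then on average at most $\eta\mu$ points of the random set
have a neighbour in it, where $\mu = p |A|$. Outside an event of probability $\sqrt\eta$ there are fewer than $\sqrt\eta\mu$ of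
them, and outside an event of probability $4/\mu$ the random set has more than $\mu/2$ points. Then the
points without a neighbour form an independent set that misses at most a proportion $2\sqrt\eta$.\<close>

lemma prob_large_independent_subset:
  assumes "finite A" "p \<in> {0..1}" "E \<subseteq> A \<times> A" "\<And>x. (x, x) \<notin> E"
    and "p * real (card A) > 0" "\<eta> > 0" "p * real (card E) \<le> \<eta> * real (card A)"
  shows "1 - sqrt \<eta> - 4 / (p * real (card A)) \<le> measure_pmf.prob (binomial_subset A p)
    {\<Omega>. \<Omega> \<subseteq> A \<and> (\<exists>B\<subseteq>\<Omega>. (1 - 2 * sqrt \<eta>) * real (card \<Omega>) \<le> real (card B) \<and> (\<forall>x\<in>B. \<forall>y\<in>B. (x, y) \<notin> E))}"
    (is "_ \<le> measure_pmf.prob ?M ?Good")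
proof -
  define \<mu> where "\<mu> = p * real (card A)"
  define bad where "bad \<Omega> = {x\<in>\<Omega>. \<exists>y\<in>\<Omega>. (x, y) \<in> E}" for \<Omega>
  let ?F = "{\<Omega>. sqrt \<eta> * \<mu> \<le> real (card (bad \<Omega>))}"
  let ?G = "{\<Omega>. real (card \<Omega>) \<le> \<mu> / 2}"
  note fin = finite_set_pmf_binomial_subset[OF assms(1), of p]
  have pos: "\<mu> > 0" "sqrt \<eta> > 0" using assms by (auto simp: \<mu>_def)
  have F: "measure_pmf.prob ?M ?F \<le> sqrt \<eta>"
  proof -
    have "measure_pmf.prob ?M ?F \<le> measure_pmf.expectation ?M (\<lambda>\<Omega>. real (card (bad \<Omega>))) / (sqrt \<eta> * \<mu>)"
      using pos by (intro pmf_Markov fin) auto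
    also have "\<dots> \<le> (\<eta> * \<mu>) / (sqrt \<eta> * \<mu>)"
    proof (rule divide_right_mono)
      have "measure_pmf.expectation ?M (\<lambda>\<Omega>. real (card (bad \<Omega>))) \<le> p * (p * real (card E))"
        using expectation_bad_points_le[OF assms(1-4)] by (simp add: bad_def power2_eq_square mult_ac)
      also have "\<dots> \<le> p * (\<eta> * real (card A))"
        using assms by (intro mult_left_mono) auto
      finally show "measure_pmf.expectation ?M (\<lambda>\<Omega>. real (card (bad \<Omega>))) \<le> \<eta> * \<mu>"
        by (simp add: \<mu>_def mult_ac)
    qed (use pos in auto)
    also have "\<dots> = sqrt \<eta>" using pos assms by (simp add: real_div_sqrt)
    finally show ?thesis .
  qed
  have G: "measure_pmf.prob ?M ?G \<le> 4 / \<mu>"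
    using prob_binomial_subset_small[OF assms(1,2,5)] by (simp add: \<mu>_def)
  have "1 = measure_pmf.prob ?M (Pow A)"
    using set_pmf_binomial_subset[OF assms(1), of p] by (simp add: measure_pmf.prob_eq_1 AE_measure_pmf_iff subset_iff)
  also have "\<dots> \<le> measure_pmf.prob ?M (?Good \<union> (?F \<union> ?G))"
  proof (intro measure_pmf.finite_measure_mono subsetI)
    fix \<Omega> assume \<Omega>: "\<Omega> \<in> Pow A"
    show "\<Omega> \<in> ?Good \<union> (?F \<union> ?G)"
    proof (cases "\<Omega> \<in> ?F \<union> ?G")
      case False
      then have few: "real (card (bad \<Omega>)) \<le> sqrt \<eta> * \<mu>" and large: "\<mu> / 2 \<le> real (card \<Omega>)" by auto
      have fin\<Omega>: "finite \<Omega>" using \<Omega> assms(1) finite_subset by blast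
      have sub: "bad \<Omega> \<subseteq> \<Omega>" by (auto simp: bad_def)
      have "real (card (\<Omega> - bad \<Omega>)) = real (card \<Omega>) - real (card (bad \<Omega>))"
        using sub fin\<Omega> by (simp add: card_Diff_subset finite_subset card_mono of_nat_diff)
      also have "\<dots> \<ge> real (card \<Omega>) - sqrt \<eta> * (2 * real (card \<Omega>))"
      proof -
        have "sqrt \<eta> * \<mu> \<le> sqrt \<eta> * (2 * real (card \<Omega>))" using pos large by (intro mult_left_mono) auto
        then show ?thesis using few by linarith
      qed
      finally have "(1 - 2 * sqrt \<eta>) * real (card \<Omega>) \<le> real (card (\<Omega> - bad \<Omega>))"
        by (simp add: algebra_simps)
      moreover have "\<forall>x\<in>\<Omega> - bad \<Omega>. \<forall>y\<in>\<Omega> - bad \<Omega>. (x, y) \<notin> E" by (auto simp: bad_def)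
      ultimately show ?thesis using \<Omega> by blast
    qed blast
  qed simp
  also have "\<dots> \<le> measure_pmf.prob ?M ?Good + (measure_pmf.prob ?M ?F + measure_pmf.prob ?M ?G)"
    by (intro order_trans[OF measure_Un_le] add_left_mono measure_Un_le) auto
  finally show ?thesis using F G by (simp add: \<mu>_def)
qed

lemma card_distance_pairs_le:
  fixes A :: "(int ^ 'd::finite) set"
  assumes "finite A" "finite D"
  shows "card {(x, y)\<in>A \<times> A. norm_sq (x - y) \<in> D} \<le>
    card A * (\<Sum>m\<in>D. card (lattice_sphere m :: (int ^ 'd) set))"
proof -
  let ?V = "\<Union>m\<in>D. lattice_sphere m :: (int ^ 'd) set"
  have "card {(x, y)\<in>A \<times> A. norm_sq (x - y) \<in> D} \<le> card (A \<times> ?V)"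
  proof (rule card_inj_on_le)
    show "inj_on (\<lambda>(x, y). (x, x - y)) {(x, y)\<in>A \<times> A. norm_sq (x - y) \<in> D}"
      by (auto simp: inj_on_def)
    show "(\<lambda>(x, y). (x, x - y)) ` {(x, y)\<in>A \<times> A. norm_sq (x - y) \<in> D} \<subseteq> A \<times> ?V"
      by (auto simp: lattice_sphere_def)
    show "finite (A \<times> ?V)" using assms finite_lattice_sphere by auto
  qed
  also have "\<dots> = card A * card ?V" by (rule card_cartesian_product)
  also have "\<dots> \<le> card A * (\<Sum>m\<in>D. card (lattice_sphere m :: (int ^ 'd) set))"
    using assms by (intro mult_left_mono card_UN_le) auto
  finally show ?thesis .
qed

section \<open>Avoiding a sparse set of distances\<close>

text \<open>The graph to be made edgeless joins points of the box whose squared distance is $q^2\lambda_N$ for some scale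
$q$. By the sphere bound its average degree times $p_N$ is at most a constant times
$p_N \lambda_N^{(d-2)/2}$, which is the $(d-2)/2$-th power of the ratio that tends to 0 by assumption.\<close>

theorem proposition2:
  fixes \<delta> \<gamma> :: real and r s J :: nat and lam :: "nat \<Rightarrow> int"
  assumes "CARD('d::finite) \<ge> 5"
    and "0 < \<gamma>" and "\<gamma> < real CARD('d) - 2"
    and "0 < \<delta>" and "\<delta> < 1"
    and "r \<ge> 2" and "s > r"
    and "\<exists>c0>0. \<exists>c1>0. \<exists>c2>0. \<exists>c>0. property_P TYPE('d) \<delta> \<gamma> r s J c0 c1 c2 c"
    and "\<And>N. lam N > 0"
    and "(\<lambda>N. real_of_int (lam N)) \<in>
           o(\<lambda>N. retention_prob \<gamma> N powr (- 2 / (real CARD('d) - 2)))"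
  shows "\<exists>\<epsilon> :: nat \<Rightarrow> real. \<epsilon> \<longlonglongrightarrow> 0 \<and>
    (\<lambda>N. measure_pmf.prob (random_box \<gamma> N :: (int ^ 'd) set pmf)
      {\<Omega>. \<exists>B\<subseteq>\<Omega>. real (card B) \<ge> (1 - \<epsilon> N) * real (card \<Omega>) \<and>
        sq_dists B \<inter> {(int q)\<^sup>2 * lam N | q. q \<in> scales r s J} = {}})
    \<longlonglongrightarrow> 1"
proof -
  let ?d = "real CARD('d)"
  let ?e = "(?d - 2) / 2"
  let ?p = "retention_prob \<gamma>"
  let ?Q = "\<lambda>N. lattice_box N :: (int ^ 'd) set"
  let ?S = "scales r s J"
  obtain C where C: "C \<ge> 0" "\<And>m. m > 0 \<Longrightarrow>
      real (card (lattice_sphere m :: (int ^ 'd) set)) \<le> C * real_of_int m powr ?e"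
    using card_lattice_sphere_le[OF assms(1)] by blast
  have finS: "finite ?S"
  proof -
    have "?S = (\<lambda>j. r ^ j * s ^ (J - j)) ` {..J}" by (auto simp: scales_def)
    then show ?thesis by simp
  qed
  have S_pos: "q > 0" if "q \<in> ?S" for q using that assms by (auto simp: scales_def)
  define D where "D N = (\<lambda>q. (int q)\<^sup>2 * lam N) ` ?S" for N
  have D_pos: "m > 0" if "m \<in> D N" for m N
    using that S_pos assms(9) by (auto simp: D_def)
  define C' where "C' = C * (\<Sum>q\<in>?S. (real q)\<^sup>2 powr ?e)"
  define t where "t N = real_of_int (lam N) / ?p N powr (- 2 / (?d - 2))" for N
  \<comment> \<open>The summand $1/(N+1)$ keeps $\eta_N$ positive, as the threshold in Markov's inequality requires.\<close>
  define \<eta> where "\<eta> N = C' * t N powr ?e + 1 / real (Suc N)" for N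
  define \<epsilon> where "\<epsilon> N = 2 * sqrt (\<eta> N)" for N
  have e: "?e > 0" using assms(1) by simp
  have C'0: "C' \<ge> 0" using C by (auto simp: C'_def intro!: mult_nonneg_nonneg sum_nonneg)
  have lam0: "real_of_int (lam N) > 0" for N using assms(9) by simp

  have "t \<longlonglongrightarrow> 0" unfolding t_def using smalloD_tendsto[OF assms(10)] by simp
  moreover have "t N \<ge> 0" for N using lam0[of N] by (simp add: t_def)
  ultimately have "(\<lambda>N. t N powr ?e) \<longlonglongrightarrow> 0"
    using e by (intro tendsto_zero_powrI) auto
  then have "\<eta> \<longlonglongrightarrow> C' * 0 + 0"
    unfolding \<eta>_def by (intro tendsto_add tendsto_mult tendsto_const LIMSEQ_Suc[OF lim_1_over_n])
  then have \<eta>: "\<eta> \<longlonglongrightarrow> 0" by simp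
  have sqrt_\<eta>: "(\<lambda>N. sqrt (\<eta> N)) \<longlonglongrightarrow> 0"
    using tendsto_real_sqrt[OF \<eta>] by simp
  then have \<epsilon>: "\<epsilon> \<longlonglongrightarrow> 0" unfolding \<epsilon>_def by (rule tendsto_mult_right_zero)

  have spheres: "?p N * (\<Sum>m\<in>D N. real (card (lattice_sphere m :: (int ^ 'd) set))) \<le> \<eta> N" if N: "N \<ge> 1" for N
  proof -
    have p: "?p N > 0" using N by (simp add: retention_prob_def)
    have "(\<Sum>m\<in>D N. real (card (lattice_sphere m :: (int ^ 'd) set))) \<le> (\<Sum>m\<in>D N. C * real_of_int m powr ?e)"
      by (intro sum_mono C(2) D_pos)
    also have "\<dots> \<le> (\<Sum>q\<in>?S. C * real_of_int ((int q)\<^sup>2 * lam N) powr ?e)"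
      unfolding D_def using C(1) by (intro sum_image_le[OF finS, unfolded o_def]) auto
    also have "\<dots> = C' * real_of_int (lam N) powr ?e"
      using lam0[of N] by (simp add: C'_def powr_mult sum_distrib_left sum_distrib_right mult.assoc)
    finally have "?p N * (\<Sum>m\<in>D N. real (card (lattice_sphere m :: (int ^ 'd) set))) \<le>
        ?p N * (C' * real_of_int (lam N) powr ?e)"
      using p by (intro mult_left_mono) auto
    also have "\<dots> = C' * t N powr ?e"
    proof -
      have "t N powr ?e = real_of_int (lam N) powr ?e / (?p N powr (- 2 / (?d - 2))) powr ?e"
        using lam0[of N] by (simp add: t_def powr_divide)
      also have "(?p N powr (- 2 / (?d - 2))) powr ?e = ?p N powr (- 1)"
      proof -
        have "- 2 / (?d - 2) * ?e = - 1" using e by simp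
        then show ?thesis by (simp only: powr_powr)
      qed
      also have "\<dots> = 1 / ?p N" using p by (simp add: powr_minus_divide)
      finally show ?thesis by simp
    qed
    also have "\<dots> \<le> \<eta> N" by (simp add: \<eta>_def)
    finally show ?thesis .
  qed

  define P where "P N = measure_pmf.prob (random_box \<gamma> N :: (int ^ 'd) set pmf)
      {\<Omega>. \<exists>B\<subseteq>\<Omega>. real (card B) \<ge> (1 - \<epsilon> N) * real (card \<Omega>) \<and>
        sq_dists B \<inter> {(int q)\<^sup>2 * lam N | q. q \<in> ?S} = {}}" for N
  have lower: "1 - sqrt (\<eta> N) - 4 * real N powr (\<gamma> - ?d) \<le> P N" if N: "N \<ge> 1" for N
  proof -
    define E where "E = {(x, y)\<in>?Q N \<times> ?Q N. norm_sq (x - y) \<in> D N}"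
    have p: "?p N > 0" "?p N \<in> {0..1}"
      using N assms(2) powr_mono[of "- \<gamma>" 0 "real N"] by (auto simp: retention_prob_def)
    have \<mu>: "real N powr (?d - \<gamma>) \<le> ?p N * real (card (?Q N))"
    proof -
      have "real N powr (?d - \<gamma>) = ?p N * real N ^ CARD('d)"
        using N by (simp add: retention_prob_def powr_diff powr_minus powr_realpow divide_inverse)
      also have "\<dots> \<le> ?p N * (2 * real N + 1) ^ CARD('d)"
        using p by (intro mult_left_mono power_mono) auto
      finally show ?thesis by (simp add: card_lattice_box add.commute)
    qed
    have \<mu>0: "real N powr (?d - \<gamma>) > 0" using N by simp
    have \<mu>1: "?p N * real (card (?Q N)) > 0" by (rule less_le_trans[OF \<mu>0 \<mu>])
    have E_le: "?p N * real (card E) \<le> \<eta> N * real (card (?Q N))"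
    proof -
      have "card E \<le> card (?Q N) * (\<Sum>m\<in>D N. card (lattice_sphere m :: (int ^ 'd) set))"
        unfolding E_def by (rule card_distance_pairs_le) (auto simp: finite_lattice_box D_def finS)
      then have "real (card E) \<le> real (card (?Q N) * (\<Sum>m\<in>D N. card (lattice_sphere m :: (int ^ 'd) set)))"
        by (simp only: of_nat_le_iff)
      then have "?p N * real (card E) \<le>
          ?p N * (real (card (?Q N)) * (\<Sum>m\<in>D N. real (card (lattice_sphere m :: (int ^ 'd) set))))"
        using p by (intro mult_left_mono) auto
      also have "\<dots> = (?p N * (\<Sum>m\<in>D N. real (card (lattice_sphere m :: (int ^ 'd) set)))) * real (card (?Q N))"
        by simp
      also have "\<dots> \<le> \<eta> N * real (card (?Q N))"
        by (intro mult_right_mono spheres N) auto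
      finally show ?thesis .
    qed
    have \<eta>0: "\<eta> N > 0" using C'0 by (auto simp: \<eta>_def intro!: add_nonneg_pos mult_nonneg_nonneg)
    \<comment> \<open>A point is not joined to itself because the forbidden distances are positive.\<close>
    have irrefl: "(x, x) \<notin> E" for x
      using D_pos[of 0 N] by (auto simp: E_def norm_sq_def)
    have "4 / (?p N * real (card (?Q N))) \<le> 4 / real N powr (?d - \<gamma>)"
      by (intro divide_left_mono \<mu> mult_pos_pos \<mu>0 \<mu>1) auto
    also have "\<dots> = 4 * real N powr (\<gamma> - ?d)"
      using powr_minus_divide[of "real N" "?d - \<gamma>"] by simp
    finally have "1 - sqrt (\<eta> N) - 4 * real N powr (\<gamma> - ?d) \<le>
        1 - sqrt (\<eta> N) - 4 / (?p N * real (card (?Q N)))" by simp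
    also have "\<dots> \<le> measure_pmf.prob (binomial_subset (?Q N) (?p N))
        {\<Omega>. \<Omega> \<subseteq> ?Q N \<and> (\<exists>B\<subseteq>\<Omega>. (1 - 2 * sqrt (\<eta> N)) * real (card \<Omega>) \<le> real (card B) \<and>
          (\<forall>x\<in>B. \<forall>y\<in>B. (x, y) \<notin> E))}"
      by (intro prob_large_independent_subset finite_lattice_box p \<eta>0 E_le irrefl \<mu>1)
        (auto simp: E_def)
    also have "\<dots> \<le> P N"
      unfolding P_def random_box_def
    proof (intro measure_pmf.finite_measure_mono subsetI CollectI)
      fix \<Omega>
      assume "\<Omega> \<in> {\<Omega>. \<Omega> \<subseteq> ?Q N \<and> (\<exists>B\<subseteq>\<Omega>. (1 - 2 * sqrt (\<eta> N)) * real (card \<Omega>) \<le> real (card B) \<and>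
          (\<forall>x\<in>B. \<forall>y\<in>B. (x, y) \<notin> E))}"
      then obtain B where B: "\<Omega> \<subseteq> ?Q N" "B \<subseteq> \<Omega>" "(1 - 2 * sqrt (\<eta> N)) * real (card \<Omega>) \<le> real (card B)"
          "\<And>x y. x \<in> B \<Longrightarrow> y \<in> B \<Longrightarrow> (x, y) \<notin> E" by blast
      have "sq_dists B \<inter> {(int q)\<^sup>2 * lam N | q. q \<in> ?S} = {}"
        using B unfolding sq_dists_def E_def D_def by blast
      then show "\<exists>B\<subseteq>\<Omega>. real (card B) \<ge> (1 - \<epsilon> N) * real (card \<Omega>) \<and>
          sq_dists B \<inter> {(int q)\<^sup>2 * lam N | q. q \<in> ?S} = {}"
        using B(2,3) unfolding \<epsilon>_def by blast
    qed simp
    finally show ?thesis .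
  qed
  have "(\<lambda>N. real N powr (\<gamma> - ?d)) \<longlonglongrightarrow> 0"
    using assms(3) by (intro tendsto_neg_powr filterlim_real_sequentially) auto
  then have "(\<lambda>N. 1 - sqrt (\<eta> N) - 4 * real N powr (\<gamma> - ?d)) \<longlonglongrightarrow> 1 - 0 - 4 * 0"
    by (intro tendsto_intros sqrt_\<eta>)
  then have "P \<longlonglongrightarrow> 1"
  proof (intro tendsto_sandwich[of "\<lambda>N. 1 - sqrt (\<eta> N) - 4 * real N powr (\<gamma> - ?d)" P sequentially "\<lambda>_. 1"])
    show "\<forall>\<^sub>F N in sequentially. 1 - sqrt (\<eta> N) - 4 * real N powr (\<gamma> - ?d) \<le> P N"
      using lower eventually_ge_at_top[of 1] by (rule eventually_mono[rotated]) 
    show "\<forall>\<^sub>F N in sequentially. P N \<le> 1" by (simp add: P_def)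
  qed simp_all
  with \<epsilon> show ?thesis unfolding P_def by blast
qed

end
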